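(* Let $\Gamma=\mathrm{Heis}_3(\mathbb Z)\subset G=\mathrm{Heis}_3(\mathbb R)$ and let $h=x_1=p/q\in\mathbb Q\cap(0,1]$ with $p,q$ relatively prime positive integers. Then the restriction to $\Gamma$ of the Schrödinger representation $\rho_h$ of $G$ decomposes, up to unitary equivalence, as the Hilbert direct integral $$ \rho_h\big|_{\Gamma}\;\simeq\;\int_0^1\!\!\int_0^1\rho_{\mathrm{fin},(x_1,\{q x_1x_2\},x_3)}\,dm(x_2)\,dm(x_3), $$ where $\{a\}$ denotes the fractional part of $a\in\mathbb R$ and $dm$ is Lebesgue measure on $[0,1)$.
   Context: Elements of $G=\mathrm{Heis}_3(\mathbb R)$ are written $(z,y,x)=\begin{pmatrix}1&x&z\\0&1&y\\0&0&1\end{pmatrix}$, and elements of $\Gamma=\mathrm{Heis}_3(\mathbb Z)$ are $n=[n_1,n_2,n_3]=\begin{pmatrix}1&n_3&n_1\\0&1&n_2\\0&0&1\end{pmatrix}$ with $n_i\in\mathbb Z$. For $h\in\mathbb R\setminus\{0\}$ the Schrödinger representation $\rho_h$ of $G$ on $L^2(\mathbb R)$ is $$(\rho_h(z,y,x)f)(s)=e^{2\pi i h(z+sy)}f(s+x).$$ For $x=(x_1,x_2,x_3)\in(\mathbb Q\cap(0,1])\times[0,1)\times[0,1)$ with $x_1=p/q$ in lowest terms, $\rho_{\mathrm{fin},x}$ is the $q$-dimensional irreducible unitary representation of $\Gamma$ on $\mathbb C^q$ (functions $\varphi$ of $k\in\mathbb Z/q\mathbb Z$) given by $$(\rho_{\mathrm{fin},x}(n)\varphi)(k)=\exp\Bigl(\tfrac{2\pi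 i}{q}\bigl(n_3x_3+n_2x_2+n_1qx_1+k\,n_2\,q\,x_1\bigr)\Bigr)\varphi(k+n_3).$$ *)

theory Defs
  imports "HOL-Analysis.Analysis" "HOL-Algebra.Group"
begin

section \<open>Complex inner product spaces with explicit carriers\<close>

text \<open>The inner product is linear in the first argument and conjugate linear in the second.\<close>

record 'v ip_space = "'v partial_object" +
  vadd :: "'v \<Rightarrow> 'v \<Rightarrow> 'v"
  vscale :: "complex \<Rightarrow> 'v \<Rightarrow> 'v"
  vinner :: "'v \<Rightarrow> 'v \<Rightarrow> complex"

definition unitary_op :: "'v ip_space \<Rightarrow> 'w ip_space \<Rightarrow> ('v \<Rightarrow> 'w) \<Rightarrow> bool" where
  "unitary_op H K U \<longleftrightarrow>
     bij_betw U (carrier H) (carrier K) \<and>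
     (\<forall>v\<in>carrier H. \<forall>w\<in>carrier H. U (vadd H v w) = vadd K (U v) (U w)) \<and>
     (\<forall>c. \<forall>v\<in>carrier H. U (vscale H c v) = vscale K c (U v)) \<and>
     (\<forall>v\<in>carrier H. \<forall>w\<in>carrier H. vinner K (U v) (U w) = vinner H v w)"

text \<open>Unitary representations of a discrete group: there is no continuity requirement.\<close>

definition unitary_rep :: "'g monoid \<Rightarrow> 'v ip_space \<Rightarrow> ('g \<Rightarrow> 'v \<Rightarrow> 'v) \<Rightarrow> bool" where
  "unitary_rep G H \<pi> \<longleftrightarrow>
     (\<forall>g\<in>carrier G. unitary_op H H (\<pi> g)) \<and>
     (\<forall>g\<in>carrier G. \<forall>h\<in>carrier G. \<forall>v\<in>carrier H. \<pi> (g \<otimes>\<^bsub>G\<^esub> h) v = \<pi> g (\<pi> h v)) \<and>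
     (\<forall>v\<in>carrier H. \<pi> \<one>\<^bsub>G\<^esub> v = v)"

definition unitarily_equivalent ::
    "'g monoid \<Rightarrow> 'v ip_space \<Rightarrow> ('g \<Rightarrow> 'v \<Rightarrow> 'v) \<Rightarrow> 'w ip_space \<Rightarrow> ('g \<Rightarrow> 'w \<Rightarrow> 'w) \<Rightarrow> bool" where
  "unitarily_equivalent G H \<pi> K \<sigma> \<longleftrightarrow>
     unitary_rep G H \<pi> \<and> unitary_rep G K \<sigma> \<and>
     (\<exists>U. unitary_op H K U \<and>
          (\<forall>g\<in>carrier G. \<forall>v\<in>carrier H. U (\<pi> g v) = \<sigma> g (U v)))"


section \<open>Spaces of almost-everywhere classes\<close>

text \<open>
  Given a family \<open>H\<close> of inner product spaces over a measure space \<open>M\<close> and a set \<open>S\<close> of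
  square-integrable sections, this is \<open>S\<close> modulo equality almost everywhere, with the pointwise
  operations and the integrated inner product. The value of a section outside
  \<open>space M\<close> is irrelevant, since all its variants lie in the same class.
\<close>

definition ae_rel :: "'x measure \<Rightarrow> ('x \<Rightarrow> 'v) set \<Rightarrow> (('x \<Rightarrow> 'v) \<times> ('x \<Rightarrow> 'v)) set" where
  "ae_rel M S = {(s, t). s \<in> S \<and> t \<in> S \<and> (AE x in M. s x = t x)}"

definition class_space ::
    "'x measure \<Rightarrow> ('x \<Rightarrow> 'v ip_space) \<Rightarrow> ('x \<Rightarrow> 'v) set \<Rightarrow> ('x \<Rightarrow> 'v) set ip_space" where
  "class_space M H S =
    \<lparr> carrier = S // ae_rel M S,
      vadd = (\<lambda>A B. {u \<in> S. \<exists>s\<in>A. \<exists>t\<in>B. AE x in M. u x = vadd (H x) (s x) (t x)}),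
      vscale = (\<lambda>c A. {u \<in> S. \<exists>s\<in>A. AE x in M. u x = vscale (H x) c (s x)}),
      vinner = (\<lambda>A B. THE c. \<exists>s\<in>A. \<exists>t\<in>B. c = (\<integral>x. vinner (H x) (s x) (t x) \<partial>M)) \<rparr>"

definition complex_line :: "complex ip_space" where
  "complex_line = \<lparr> carrier = UNIV, vadd = (+), vscale = (*), vinner = (\<lambda>z w. z * cnj w) \<rparr>"

definition L2_functions :: "'x measure \<Rightarrow> ('x \<Rightarrow> complex) set" where
  "L2_functions M = {f \<in> borel_measurable M. integrable M (\<lambda>x. (cmod (f x))\<^sup>2)}"

definition L2_space :: "'x measure \<Rightarrow> ('x \<Rightarrow> complex) set ip_space" where
  "L2_space M = class_space M (\<lambda>_. complex_line) (L2_functions M)"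


section \<open>Direct integrals\<close>

text \<open>
  A measurable field of Hilbert spaces is a family \<open>H\<close> together with a fundamental sequence
  \<open>e\<close> of sections: their mutual inner products are measurable and they are total in every fibre.
  A section is measurable if its inner products with the members of \<open>e\<close> are.
\<close>

definition fundamental_sequence ::
    "'x measure \<Rightarrow> ('x \<Rightarrow> 'v ip_space) \<Rightarrow> (nat \<Rightarrow> 'x \<Rightarrow> 'v) \<Rightarrow> bool" where
  "fundamental_sequence M H e \<longleftrightarrow>
     (\<forall>n. \<forall>x\<in>space M. e n x \<in> carrier (H x)) \<and>
     (\<forall>m n. (\<lambda>x. vinner (H x) (e m x) (e n x)) \<in> borel_measurable M) \<and>
     (\<forall>x\<in>space M. \<forall>v\<in>carrier (H x). (\<forall>n. vinner (H x) v (e n x) = 0) \<longrightarrow> vinner (H x) v v = 0)"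

definition L2_sections ::
    "'x measure \<Rightarrow> ('x \<Rightarrow> 'v ip_space) \<Rightarrow> (nat \<Rightarrow> 'x \<Rightarrow> 'v) \<Rightarrow> ('x \<Rightarrow> 'v) set" where
  "L2_sections M H e =
     {s. (\<forall>x\<in>space M. s x \<in> carrier (H x)) \<and>
         (\<forall>n. (\<lambda>x. vinner (H x) (s x) (e n x)) \<in> borel_measurable M) \<and>
         integrable M (\<lambda>x. Re (vinner (H x) (s x) (s x)))}"

definition direct_integral ::
    "'x measure \<Rightarrow> ('x \<Rightarrow> 'v ip_space) \<Rightarrow> (nat \<Rightarrow> 'x \<Rightarrow> 'v) \<Rightarrow> ('x \<Rightarrow> 'v) set ip_space" where
  "direct_integral M H e = class_space M H (L2_sections M H e)"

definition direct_integral_rep ::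
    "'x measure \<Rightarrow> ('x \<Rightarrow> 'v ip_space) \<Rightarrow> (nat \<Rightarrow> 'x \<Rightarrow> 'v) \<Rightarrow> ('x \<Rightarrow> 'g \<Rightarrow> 'v \<Rightarrow> 'v) \<Rightarrow>
      'g \<Rightarrow> ('x \<Rightarrow> 'v) set \<Rightarrow> ('x \<Rightarrow> 'v) set" where
  "direct_integral_rep M H e \<pi> g A =
     {u \<in> L2_sections M H e. \<exists>s\<in>A. AE x in M. u x = \<pi> x g (s x)}"


section \<open>The Heisenberg group and its representations\<close>

definition heis :: "'a \<Rightarrow> 'a \<Rightarrow> 'a \<Rightarrow> 'a::comm_ring_1 ^ 3 ^ 3" where
  "heis z y x = vector [vector [1, x, z], vector [0, 1, y], vector [0, 0, 1]]"

definition heis_group :: "('a::comm_ring_1 ^ 3 ^ 3) monoid" where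
  "heis_group = \<lparr> carrier = {heis z y x | z y x. True}, mult = (**), one = mat 1 \<rparr>"

abbreviation heis_Z :: "(int ^ 3 ^ 3) monoid" where "heis_Z \<equiv> heis_group"

definition heis_inclusion :: "int ^ 3 ^ 3 \<Rightarrow> real ^ 3 ^ 3" where
  "heis_inclusion n = (\<chi> i j. real_of_int (n $ i $ j))"

definition schroedinger ::
    "real \<Rightarrow> real ^ 3 ^ 3 \<Rightarrow> (real \<Rightarrow> complex) set \<Rightarrow> (real \<Rightarrow> complex) set" where
  "schroedinger h g A =
    (let z = g $ 1 $ 3; y = g $ 2 $ 3; x = g $ 1 $ 2 in
     {u \<in> L2_functions lborel. \<exists>f\<in>A. AE s in lborel.
        u s = exp (2 * complex_of_real pi * \<i> * of_real (h * (z + s * y))) * f (s + x)})"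

definition rat_denom :: "rat \<Rightarrow> int" where
  "rat_denom r = snd (quotient_of r)"

text \<open>Functions on \<open>\<int>/q\<int>\<close> are \<open>q\<close>-periodic functions on \<open>\<int>\<close>.\<close>

definition cyclic_space :: "int \<Rightarrow> (int \<Rightarrow> complex) ip_space" where
  "cyclic_space q =
    \<lparr> carrier = {\<phi>. \<forall>k. \<phi> (k + q) = \<phi> k},
      vadd = (\<lambda>\<phi> \<psi> k. \<phi> k + \<psi> k),
      vscale = (\<lambda>c \<phi> k. c * \<phi> k),
      vinner = (\<lambda>\<phi> \<psi>. \<Sum>k\<in>{0..<q}. \<phi> k * cnj (\<psi> k)) \<rparr>"

definition cyclic_delta :: "int \<Rightarrow> nat \<Rightarrow> int \<Rightarrow> complex" where
  "cyclic_delta q n = (\<lambda>k. if k mod q = int n mod q then 1 else 0)"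

definition rho_fin ::
    "rat \<times> real \<times> real \<Rightarrow> int ^ 3 ^ 3 \<Rightarrow> (int \<Rightarrow> complex) \<Rightarrow> int \<Rightarrow> complex" where
  "rho_fin = (\<lambda>(x1, x2, x3) n \<phi> k.
    (let q = real_of_int (rat_denom x1);
         n1 = n $ 1 $ 3; n2 = n $ 2 $ 3; n3 = n $ 1 $ 2 in
     exp (2 * complex_of_real pi * \<i> / of_real q *
          of_real (of_int n3 * x3 + of_int n2 * x2 + of_int n1 * q * of_rat x1
                   + of_int k * of_int n2 * q * of_rat x1))
     * \<phi> (k + n3)))"

lemma fundamental_sequence_cyclic_delta:
  assumes "q > 0"
  shows "fundamental_sequence M (\<lambda>_. cyclic_space q) (\<lambda>n _. cyclic_delta q n)"
proof -
  have zero: "v k = 0"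
    if v: "\<forall>n. (\<Sum>k\<in>{0..<q}. v k * cnj (cyclic_delta q n k)) = 0" and k: "k \<in> {0..<q}"
    for v :: "int \<Rightarrow> complex" and k
  proof -
    have "0 = (\<Sum>j\<in>{0..<q}. v j * cnj (cyclic_delta q (nat k) j))"
      using v by simp
    also have "\<dots> = (\<Sum>j\<in>{0..<q}. if j = k then v j else 0)"
      using k by (intro sum.cong) (auto simp: cyclic_delta_def)
    also have "\<dots> = v k" using k by simp
    finally show ?thesis by simp
  qed
  have "(\<Sum>k\<in>{0..<q}. v k * cnj (v k)) = 0"
    if "\<forall>n. (\<Sum>k\<in>{0..<q}. v k * cnj (cyclic_delta q n k)) = 0" for v
    by (intro sum.neutral ballI) (simp add: zero[OF that])
  then show ?thesis
    by (simp add: fundamental_sequence_def cyclic_space_def) (simp add: cyclic_delta_def)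
qed

lemma group_heis_group: "group (heis_group :: ('a::comm_ring_1 ^ 3 ^ 3) monoid)"
proof (rule groupI)
  have mult: "heis z y x ** heis z' y' x' = heis (z + z' + x * y') (y + y') (x + x')"
    for z y x z' y' x' :: 'a
    by (simp add: heis_def vec_eq_iff forall_3 matrix_matrix_mult_def sum_3 algebra_simps)
  have one: "mat 1 = (heis 0 0 0 :: 'a ^ 3 ^ 3)"
    by (simp add: heis_def vec_eq_iff forall_3 mat_def)
  show "a \<otimes>\<^bsub>heis_group\<^esub> b \<in> carrier heis_group"
    if "a \<in> carrier heis_group" "b \<in> carrier heis_group" for a b :: "'a ^ 3 ^ 3"
    using that by (simp add: heis_group_def) (metis mult)
  show "\<one>\<^bsub>heis_group\<^esub> \<in> carrier (heis_group :: ('a ^ 3 ^ 3) monoid)"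
    by (auto simp: heis_group_def one)
  show "\<exists>b\<in>carrier heis_group. b \<otimes>\<^bsub>heis_group\<^esub> a = \<one>\<^bsub>heis_group\<^esub>"
    if "a \<in> carrier heis_group" for a :: "'a ^ 3 ^ 3"
  proof -
    from that obtain z y x where a: "a = heis z y x" by (auto simp: heis_group_def)
    have "heis (x * y - z) (- y) (- x) ** a = mat 1" by (simp add: a mult one)
    then show ?thesis by (auto simp: heis_group_def)
  qed
qed (auto simp: heis_group_def matrix_mul_assoc)

end

theory Submission
  imports Defs
begin

text \<open>
  Write \<open>s = t + i\<close> with \<open>t\<close> in \<open>[0,1)\<close> and \<open>i\<close> an integer. An element \<open>[n1, n2, n3]\<close> acts through
  \<open>\<rho>\<^sub>h\<close> by the phase \<open>p (n1 + (t + i) n2) / q\<close> and the shift \<open>i \<mapsto> i + n3\<close>. If \<open>u p \<equiv> 1 (mod q)\<close>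
  and \<open>j = i + u \<lfloor>p t\<rfloor>\<close>, then \<open>p (t + i) \<equiv> {p t} + j p (mod q)\<close>, so the phase depends only on \<open>t\<close> and
  on \<open>j\<close> modulo \<open>q\<close>, and for fixed \<open>t\<close> a Fourier transform in \<open>j\<close> (a twisted Zak transform)
  diagonalises the remaining shifts by \<open>q\<close>. The inverse transform is the one given by
  a formula, an integral over the dual variable, on all square-integrable sections; it intertwines the
  representatives exactly, it is isometric by Parseval, and it is onto by Riesz--Fischer.
\<close>

section \<open>Unitary operators between spaces of classes\<close>

text \<open>The Schroedinger phase sees p t, while \<open>rho_fin\<close> sees only its fractional
  part. The integer part of p t varies with t, so it has to be absorbed by a t-dependent shift of
  the index; over each t this permutes the integers and so preserves norms. The forward transform is
  a series that converges only in mean. The inverse is an integral over a space of measure 1 and has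
  a value at every point, so that the intertwining relation is a pointwise identity. Additivity
  holds only almost everywhere, because the Bochner integral is 0 on non-integrable functions. Norms
  are computed in \<open>ennreal\<close>, where sums and integrals may be exchanged freely, and
  inner products are recovered by polarization. Unitarity of the direct integral representation is
  transported from the Schroedinger side instead of being checked fibrewise. The analytic input to
  Parseval is completeness of the characters on [0,1), from Stone-Weierstrass on the circle and
  inner regularity of Lebesgue measure.\<close>

lemma unitary_op_comp:
  assumes U: "unitary_op H K U" and V: "unitary_op K L V"
  shows "unitary_op H L (V \<circ> U)"
proof -
  have "U v \<in> carrier K" if "v \<in> carrier H" for v
    using U that by (auto simp: unitary_op_def bij_betw_def)
  then show ?thesis
    using U V by (auto simp: unitary_op_def intro: bij_betw_trans)
qed

text \<open>The record \<open>ip_space\<close> carries no axioms, so closure under the operations is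
  assumed: it places \<open>vadd H v w\<close> and \<open>vscale H c v\<close> in the set on which
  \<open>inv_into\<close> is a left inverse.\<close>

lemma unitary_op_inv_into:
  assumes U: "unitary_op H K U"
    and add: "\<And>v w. v \<in> carrier H \<Longrightarrow> w \<in> carrier H \<Longrightarrow> vadd H v w \<in> carrier H"
    and scale: "\<And>c v. v \<in> carrier H \<Longrightarrow> vscale H c v \<in> carrier H"
  shows "unitary_op K H (inv_into (carrier H) U)"
proof -
  let ?V = "inv_into (carrier H) U"
  have bij: "bij_betw U (carrier H) (carrier K)"
    using U by (simp add: unitary_op_def)
  have l: "?V (U v) = v" if "v \<in> carrier H" for v
    using bij that by (simp add: bij_betw_def)
  have img: "carrier K = U ` carrier H"
    using bij by (simp add: bij_betw_def)
  have a: "?V (vadd K (U v) (U w)) = vadd H v w" if "v \<in> carrier H" "w \<in> carrier H" for v w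
  proof -
    have "vadd K (U v) (U w) = U (vadd H v w)"
      using U that by (simp add: unitary_op_def)
    then show ?thesis using l add that by simp
  qed
  have s: "?V (vscale K c (U v)) = vscale H c v" if "v \<in> carrier H" for c v
  proof -
    have "vscale K c (U v) = U (vscale H c v)"
      using U that by (simp add: unitary_op_def)
    then show ?thesis using l scale that by simp
  qed
  show ?thesis
    unfolding unitary_op_def
  proof (intro conjI allI ballI)
    show "bij_betw ?V (carrier K) (carrier H)"
      using bij by (rule bij_betw_inv_into)
  qed (use U in \<open>auto simp: img l a s unitary_op_def\<close>)
qed

lemma unitary_op_cong:
  assumes "unitary_op H K U"
    and "\<And>v. v \<in> carrier H \<Longrightarrow> V v = U v"
    and "\<And>v w. v \<in> carrier H \<Longrightarrow> w \<in> carrier H \<Longrightarrow> vadd H v w \<in> carrier H"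
    and "\<And>c v. v \<in> carrier H \<Longrightarrow> vscale H c v \<in> carrier H"
  shows "unitary_op H K V"
  using assms bij_betw_cong[of "carrier H" V U "carrier K"] by (simp add: unitary_op_def)

text \<open>On \<open>K\<close> the action \<open>\<sigma>\<close> is the conjugate of
  \<open>\<pi>\<close> by the unitary \<open>V\<close>, so it inherits unitarity and the
  homomorphism law. The operator points from \<open>K\<close> to \<open>H\<close> because the
  inverse Zak transform does.\<close>

lemma unitarily_equivalent_if_intertwiner:
  assumes G: "group G" and rep: "unitary_rep G H \<pi>" and V: "unitary_op K H V"
    and closed: "\<And>g v. g \<in> carrier G \<Longrightarrow> v \<in> carrier K \<Longrightarrow> \<sigma> g v \<in> carrier K"
    and tw: "\<And>g v. g \<in> carrier G \<Longrightarrow> v \<in> carrier K \<Longrightarrow> V (\<sigma> g v) = \<pi> g (V v)"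
    and add: "\<And>v w. v \<in> carrier K \<Longrightarrow> w \<in> carrier K \<Longrightarrow> vadd K v w \<in> carrier K"
    and scale: "\<And>c v. v \<in> carrier K \<Longrightarrow> vscale K c v \<in> carrier K"
  shows "unitarily_equivalent G H \<pi> K \<sigma>"
proof -
  interpret group G by (rule G)
  let ?U = "inv_into (carrier K) V"
  have U: "unitary_op H K ?U"
    using V add scale by (rule unitary_op_inv_into)
  have bij: "bij_betw V (carrier K) (carrier H)"
    using V by (simp add: unitary_op_def)
  have UV: "?U (V v) = v" if "v \<in> carrier K" for v
    using bij that by (simp add: bij_betw_def)
  have VU: "V (?U v) = v" if "v \<in> carrier H" for v
    using bij that by (simp add: bij_betw_def f_inv_into_f)
  have Vin: "V v \<in> carrier H" if "v \<in> carrier K" for v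
    using bij that by (auto simp: bij_betw_def)
  have Uin: "?U v \<in> carrier K" if "v \<in> carrier H" for v
    using bij that by (metis bij_betw_def inv_into_into)
  have \<sigma>: "\<sigma> g v = ?U (\<pi> g (V v))" if "g \<in> carrier G" "v \<in> carrier K" for g v
    using that tw UV closed by metis
  have "unitary_rep G K \<sigma>"
    unfolding unitary_rep_def
  proof (intro conjI ballI)
    fix g assume g: "g \<in> carrier G"
    have "unitary_op K K (?U \<circ> (\<pi> g \<circ> V))"
      using g rep V U by (intro unitary_op_comp) (auto simp: unitary_rep_def)
    then show "unitary_op K K (\<sigma> g)"
      by (rule unitary_op_cong) (use g in \<open>auto simp: \<sigma> add scale\<close>)
  next
    fix g h v assume "g \<in> carrier G" "h \<in> carrier G" "v \<in> carrier K"
    then have "V (\<sigma> (g \<otimes>\<^bsub>G\<^esub> h) v) = V (\<sigma> g (\<sigma> h v))"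
      using rep Vin by (simp add: tw closed unitary_rep_def)
    then show "\<sigma> (g \<otimes>\<^bsub>G\<^esub> h) v = \<sigma> g (\<sigma> h v)"
      using \<open>g \<in> _\<close> \<open>h \<in> _\<close> \<open>v \<in> _\<close> UV closed by (metis m_closed)
  next
    fix v assume v: "v \<in> carrier K"
    then show "\<sigma> \<one>\<^bsub>G\<^esub> v = v"
      using rep Vin UV by (simp add: \<sigma> unitary_rep_def)
  qed
  moreover have "?U (\<pi> g v) = \<sigma> g (?U v)" if "g \<in> carrier G" "v \<in> carrier H" for g v
    using that VU Uin by (simp add: \<sigma>)
  ultimately show ?thesis
    using rep U by (auto simp: unitarily_equivalent_def)
qed

section \<open>Almost-everywhere classes and operators given on representatives\<close>

definition ae_class :: "'x measure \<Rightarrow> ('x \<Rightarrow> 'v) set \<Rightarrow> ('x \<Rightarrow> 'v) \<Rightarrow> ('x \<Rightarrow> 'v) set" where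
  "ae_class M S f = {u \<in> S. AE x in M. u x = f x}"

lemma carrier_class_space: "carrier (class_space M H S) = ae_class M S ` S"
proof -
  have "ae_rel M S `` {s} = ae_class M S s" if "s \<in> S" for s
    using that by (auto simp: ae_rel_def ae_class_def eq_commute)
  then show ?thesis
    by (auto simp: class_space_def quotient_def)
qed

lemma ae_class_eq_iff:
  assumes "s \<in> S"
  shows "ae_class M S s = ae_class M S t \<longleftrightarrow> (AE x in M. s x = t x)"
proof
  assume "ae_class M S s = ae_class M S t"
  moreover have "s \<in> ae_class M S s" using assms by (simp add: ae_class_def)
  ultimately show "AE x in M. s x = t x" by (simp add: ae_class_def)
next
  assume st: "AE x in M. s x = t x"
  have "(AE x in M. u x = s x) \<longleftrightarrow> (AE x in M. u x = t x)" for u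
    using st by (auto elim: AE_mp)
  then show "ae_class M S s = ae_class M S t" by (simp add: ae_class_def)
qed

text \<open>Scalar multiplication, the group actions and the integral transforms are all defined on
  classes by the set on the left. \<open>T s\<close> itself need not lie in \<open>S'\<close> here,
  so classes can be computed before membership is established.\<close>

lemma ae_class_image:
  assumes s: "s \<in> S"
    and T: "\<And>t. t \<in> S \<Longrightarrow> AE x in M. t x = s x \<Longrightarrow> AE x in M'. T t x = T s x"
  shows "{u \<in> S'. \<exists>t\<in>ae_class M S s. AE x in M'. u x = T t x} = ae_class M' S' (T s)"
proof -
  have "(\<exists>t\<in>ae_class M S s. AE x in M'. u x = T t x) \<longleftrightarrow> (AE x in M'. u x = T s x)" for u
  proof
    assume "\<exists>t\<in>ae_class M S s. AE x in M'. u x = T t x"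
    then obtain t where t: "t \<in> S" "AE x in M. t x = s x" and u: "AE x in M'. u x = T t x"
      by (auto simp: ae_class_def)
    show "AE x in M'. u x = T s x"
      using u T[OF t] by eventually_elim simp
  next
    assume "AE x in M'. u x = T s x"
    moreover have "s \<in> ae_class M S s" using s by (simp add: ae_class_def)
    ultimately show "\<exists>t\<in>ae_class M S s. AE x in M'. u x = T t x" by blast
  qed
  then show ?thesis by (simp add: ae_class_def)
qed

lemma vscale_class_space:
  assumes "s \<in> S"
  shows "vscale (class_space M H S) c (ae_class M S s) =
    ae_class M S (\<lambda>x. vscale (H x) c (s x))"
  unfolding class_space_def ip_space.simps
  by (rule ae_class_image[where T = "\<lambda>s x. vscale (H x) c (s x)"]) (use assms in auto)

lemma vadd_class_space:
  assumes s: "s \<in> S" and t: "t \<in> S"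
  shows "vadd (class_space M H S) (ae_class M S s) (ae_class M S t) =
    ae_class M S (\<lambda>x. vadd (H x) (s x) (t x))"
proof -
  have "(\<exists>a\<in>ae_class M S s. \<exists>b\<in>ae_class M S t. AE x in M. u x = vadd (H x) (a x) (b x)) \<longleftrightarrow>
    (AE x in M. u x = vadd (H x) (s x) (t x))" (is "?L \<longleftrightarrow> ?R") for u
  proof
    assume ?L
    then obtain a b where a: "AE x in M. a x = s x" and b: "AE x in M. b x = t x"
      and u: "AE x in M. u x = vadd (H x) (a x) (b x)"
      by (auto simp: ae_class_def)
    show ?R using a b u by eventually_elim simp
  next
    assume ?R
    moreover have "s \<in> ae_class M S s" "t \<in> ae_class M S t"
      using s t by (auto simp: ae_class_def)
    ultimately show ?L by blast
  qed
  then show ?thesis by (simp add: class_space_def ae_class_def)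
qed

text \<open>The Bochner integral is invariant under changes on null sets only for measurable integrands.\<close>

lemma vinner_class_space:
  assumes s: "s \<in> S" and t: "t \<in> S"
    and meas: "\<And>s t. s \<in> S \<Longrightarrow> t \<in> S \<Longrightarrow> (\<lambda>x. vinner (H x) (s x) (t x)) \<in> borel_measurable M"
  shows "vinner (class_space M H S) (ae_class M S s) (ae_class M S t) =
    (\<integral>x. vinner (H x) (s x) (t x) \<partial>M)"
proof -
  have "(\<integral>x. vinner (H x) (a x) (b x) \<partial>M) = (\<integral>x. vinner (H x) (s x) (t x) \<partial>M)"
    if "a \<in> ae_class M S s" "b \<in> ae_class M S t" for a b
  proof (rule integral_cong_AE)
    have "AE x in M. a x = s x" "AE x in M. b x = t x"
      using that by (auto simp: ae_class_def)
    then show "AE x in M. vinner (H x) (a x) (b x) = vinner (H x) (s x) (t x)"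
      by eventually_elim simp
  qed (use that s t meas in \<open>auto simp: ae_class_def\<close>)
  moreover have "s \<in> ae_class M S s" "t \<in> ae_class M S t"
    using s t by (auto simp: ae_class_def)
  ultimately have "(THE c. \<exists>a\<in>ae_class M S s. \<exists>b\<in>ae_class M S t.
      c = (\<integral>x. vinner (H x) (a x) (b x) \<partial>M)) = (\<integral>x. vinner (H x) (s x) (t x) \<partial>M)"
    by (intro the_equality) blast+
  then show ?thesis by (simp add: class_space_def)
qed

lemma class_space_closed:
  assumes add: "\<And>s t. s \<in> S \<Longrightarrow> t \<in> S \<Longrightarrow> (\<lambda>x. vadd (H x) (s x) (t x)) \<in> S"
    and scale: "\<And>c s. s \<in> S \<Longrightarrow> (\<lambda>x. vscale (H x) c (s x)) \<in> S"
  shows "v \<in> carrier (class_space M H S) \<Longrightarrow> w \<in> carrier (class_space M H S) \<Longrightarrow>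
      vadd (class_space M H S) v w \<in> carrier (class_space M H S)"
    and "v \<in> carrier (class_space M H S) \<Longrightarrow>
      vscale (class_space M H S) c v \<in> carrier (class_space M H S)"
  by (auto simp: carrier_class_space vadd_class_space vscale_class_space add scale)

text \<open>\<open>T\<close> acts on representatives. Read from right to left, \<open>T_eq\<close>
  makes the map on classes well defined; read from left to right, it makes it injective. Linearity
  is asked for almost everywhere, which is all that an integral transform offers.\<close>

lemma unitary_op_class_space:
  assumes meas: "\<And>s t. s \<in> S \<Longrightarrow> t \<in> S \<Longrightarrow> (\<lambda>x. vinner (H x) (s x) (t x)) \<in> borel_measurable M"
    and meas': "\<And>s t. s \<in> S' \<Longrightarrow> t \<in> S' \<Longrightarrow> (\<lambda>x. vinner (H' x) (s x) (t x)) \<in> borel_measurable M'"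
    and add: "\<And>s t. s \<in> S \<Longrightarrow> t \<in> S \<Longrightarrow> (\<lambda>x. vadd (H x) (s x) (t x)) \<in> S"
    and scale: "\<And>c s. s \<in> S \<Longrightarrow> (\<lambda>x. vscale (H x) c (s x)) \<in> S"
    and T: "\<And>s. s \<in> S \<Longrightarrow> T s \<in> S'"
    and T_eq: "\<And>s t. s \<in> S \<Longrightarrow> t \<in> S \<Longrightarrow> (AE x in M'. T s x = T t x) \<longleftrightarrow> (AE x in M. s x = t x)"
    and T_surj: "\<And>s'. s' \<in> S' \<Longrightarrow> \<exists>s\<in>S. AE x in M'. T s x = s' x"
    and T_add: "\<And>s t. s \<in> S \<Longrightarrow> t \<in> S \<Longrightarrow>
      AE x in M'. T (\<lambda>x. vadd (H x) (s x) (t x)) x = vadd (H' x) (T s x) (T t x)"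
    and T_scale: "\<And>c s. s \<in> S \<Longrightarrow>
      AE x in M'. T (\<lambda>x. vscale (H x) c (s x)) x = vscale (H' x) c (T s x)"
    and T_inner: "\<And>s t. s \<in> S \<Longrightarrow> t \<in> S \<Longrightarrow>
      (\<integral>x. vinner (H' x) (T s x) (T t x) \<partial>M') = (\<integral>x. vinner (H x) (s x) (t x) \<partial>M)"
  shows "unitary_op (class_space M H S) (class_space M' H' S')
    (\<lambda>A. {u \<in> S'. \<exists>s\<in>A. AE x in M'. u x = T s x})" (is "unitary_op ?C ?C' ?U")
proof -
  have U: "?U (ae_class M S s) = ae_class M' S' (T s)" if "s \<in> S" for s
    by (rule ae_class_image) (use that T_eq in auto)
  have inj: "inj_on ?U (carrier ?C)"
    by (auto simp: inj_on_def carrier_class_space U ae_class_eq_iff T T_eq)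
  have "?U ` carrier ?C = (\<lambda>s. ae_class M' S' (T s)) ` S"
    by (auto simp: carrier_class_space image_image U)
  also have "\<dots> = ae_class M' S' ` S'"
  proof (intro equalityI subsetI)
    fix A assume "A \<in> ae_class M' S' ` S'"
    then obtain s' where s': "s' \<in> S'" "A = ae_class M' S' s'" by auto
    with T_surj obtain s where "s \<in> S" "AE x in M'. T s x = s' x" by blast
    then show "A \<in> (\<lambda>s. ae_class M' S' (T s)) ` S"
      using s' T ae_class_eq_iff[of "T s" S' M' s'] by auto
  qed (use T in auto)
  finally have surj: "?U ` carrier ?C = carrier ?C'"
    by (simp add: carrier_class_space)
  show ?thesis
    unfolding unitary_op_def
  proof (intro conjI ballI allI)
    show "bij_betw ?U (carrier ?C) (carrier ?C')"
      using inj surj by (simp add: bij_betw_def)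
  next
    fix v w assume "v \<in> carrier ?C" "w \<in> carrier ?C"
    then obtain s t where [simp]: "s \<in> S" "t \<in> S" "v = ae_class M S s" "w = ae_class M S t"
      by (auto simp: carrier_class_space)
    show "?U (vadd ?C v w) = vadd ?C' (?U v) (?U w)"
      by (simp add: vadd_class_space U add T ae_class_eq_iff T_add)
    show "vinner ?C' (?U v) (?U w) = vinner ?C v w"
      by (simp add: vinner_class_space meas meas' U T T_inner)
  next
    fix c v assume "v \<in> carrier ?C"
    then obtain s where [simp]: "s \<in> S" "v = ae_class M S s"
      by (auto simp: carrier_class_space)
    show "?U (vscale ?C c v) = vscale ?C' c (?U v)"
      by (simp add: vscale_class_space U scale T ae_class_eq_iff T_scale)
  qed
qed

section \<open>Characters on the unit interval\<close>

abbreviation unit_lborel :: "real measure" where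
  "unit_lborel \<equiv> restrict_space lborel {0..<1}"

lemma emeasure_space_unit_lborel: "emeasure unit_lborel (space unit_lborel) = 1"
  by (simp add: emeasure_restrict_space space_restrict_space)

interpretation unit: finite_measure unit_lborel
  by (rule finite_measureI) (simp only: emeasure_space_unit_lborel, simp)

interpretation unit2: pair_sigma_finite unit_lborel unit_lborel ..

lemma space_unit_lborel: "space unit_lborel = {0..<1}"
  by (simp add: space_restrict_space)

lemma measurable_ident_unit_lborel [measurable (raw)]: "(\<lambda>x. x) \<in> borel_measurable unit_lborel"
  by (simp add: measurable_restrict_space1)

lemma AE_unit_lborel: "(AE x in unit_lborel. P x) \<longleftrightarrow> (AE x in lborel. x \<in> {0..<1} \<longrightarrow> P x)"
  by (simp add: AE_restrict_space_iff)

definition char :: "real \<Rightarrow> complex" where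
  "char x = cis (2 * pi * x)"

lemma char_0 [simp]: "char 0 = 1"
  by (simp add: char_def)

lemma char_add: "char (x + y) = char x * char y"
  by (simp add: char_def cis_mult algebra_simps)

lemma cnj_char: "cnj (char x) = char (- x)"
  by (simp add: char_def cis_cnj)

lemma norm_char [simp]: "cmod (char x) = 1"
  by (simp add: char_def)

lemma char_int [simp]: "char (of_int n) = 1"
  using cis_multiple_2pi[of "of_int n"] by (simp add: char_def)

lemma char_add_int: "char (x + of_int n) = char x"
  by (simp add: char_add)

lemma continuous_char [continuous_intros]:
  "continuous_on A f \<Longrightarrow> continuous_on A (\<lambda>x. char (f x))"
  unfolding char_def by (intro continuous_intros)

lemma borel_measurable_char [measurable (raw)]:
  assumes "f \<in> borel_measurable M"
  shows "(\<lambda>x. char (f x)) \<in> borel_measurable M"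
  by (rule measurable_compose[OF assms]) (intro borel_measurable_continuous_onI continuous_intros)

lemma borel_measurable_cnj [measurable (raw)]:
  assumes "f \<in> borel_measurable M"
  shows "(\<lambda>x. cnj (f x)) \<in> borel_measurable M"
  by (rule measurable_compose[OF assms]) (intro borel_measurable_continuous_onI continuous_intros)

lemma char_inj:
  assumes "x \<in> {0..<1}" "y \<in> {0..<1}" "char x = char y"
  shows "x = y"
proof -
  have "exp (\<i> * complex_of_real (2 * pi * x)) = exp (\<i> * complex_of_real (2 * pi * y))"
    using assms(3) by (simp add: char_def cis_conv_exp)
  then obtain n :: int where
    "\<i> * complex_of_real (2 * pi * x) = \<i> * complex_of_real (2 * pi * y) + of_int (2 * n) * pi * \<i>"
    using exp_eq by blast
  from arg_cong[OF this, of Im] have "2 * pi * x = 2 * pi * y + 2 * of_int n * pi"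
    by simp
  then have "pi * (x - y - of_int n) = 0" by (simp add: algebra_simps)
  then have "x - y = of_int n" by simp
  then have "of_int n < (1::real)" "of_int n > (- 1::real)"
    using assms(1,2) by auto
  then have "n = 0" by linarith
  with \<open>x - y = of_int n\<close> show ?thesis by simp
qed

text \<open>For nonzero \<open>l\<close> the primitive \<open>F\<close> has period 1, so its values
  at 0 and 1 agree. The fundamental theorem is used on the closed interval, whose extra end point is
  a null set.\<close>

lemma integral_char: "(\<integral>x. char (of_int l * x) \<partial>unit_lborel) = (if l = 0 then 1 else 0)"
proof (cases "l = 0")
  case True
  then show ?thesis by (simp add: measure_restrict_space space_restrict_space)
next
  case False
  define F where "F x = char (of_int l * x) / (2 * pi * \<i> * of_int l)" for x
  have "(F has_vector_derivative char (of_int l * x)) (at x within {0..1})" for x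
    unfolding F_def char_def has_vector_derivative_def using False
    by (auto intro!: derivative_eq_intros ext simp: field_simps scaleR_conv_of_real)
  then have "(\<integral>x. indicator {0..1} x *\<^sub>R char (of_int l * x) \<partial>lborel) = F 1 - F 0"
    by (intro integral_FTC_Icc) (auto intro!: continuous_intros)
  also have "\<dots> = 0" by (simp add: F_def)
  also have "(\<integral>x. indicator {0..1} x *\<^sub>R char (of_int l * x) \<partial>lborel) =
      (\<integral>x. indicator {0..<1} x *\<^sub>R char (of_int l * x) \<partial>lborel)"
  proof (rule integral_cong_AE)
    show "AE x in lborel. indicator {0..1} x *\<^sub>R char (of_int l * x) =
        indicator {0..<1} x *\<^sub>R char (of_int l * x)"
      using AE_lborel_singleton[of "1::real"]
      by eventually_elim (auto simp: indicator_def)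
  qed measurable
  finally show ?thesis using False by (simp add: integral_restrict_space)
qed

section \<open>Square-integrable functions on the unit interval and Bessel's identity\<close>

lemma integrable_mult_bounded:
  fixes f g :: "'a \<Rightarrow> complex"
  assumes "integrable M f" "g \<in> borel_measurable M" "\<And>x. x \<in> space M \<Longrightarrow> cmod (g x) \<le> B"
  shows "integrable M (\<lambda>x. f x * g x)"
proof (rule Bochner_Integration.integrable_bound)
  show "integrable M (\<lambda>x. B * cmod (f x))" using assms(1) by simp
  show "AE x in M. cmod (f x * g x) \<le> norm (B * cmod (f x))"
  proof (rule AE_I2)
    fix x assume "x \<in> space M"
    then have "cmod (g x) \<le> \<bar>B\<bar>" using assms(3)[of x] by linarith
    then show "cmod (f x * g x) \<le> norm (B * cmod (f x))"
      using mult_left_mono[of "cmod (g x)" "\<bar>B\<bar>" "cmod (f x)"]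
      by (simp add: norm_mult abs_mult mult.commute)
  qed
qed (use assms in measurable)

text \<open>On a finite measure space L2 lies in L1, because \<open>|z| <= 1 + |z|^2\<close> and the
  constant 1 is integrable.\<close>

lemma (in finite_measure) square_integrable_imp_integrable_complex:
  fixes f :: "'a \<Rightarrow> complex"
  assumes "f \<in> borel_measurable M" "(\<integral>\<^sup>+x. ennreal ((cmod (f x))\<^sup>2) \<partial>M) < \<infinity>"
  shows "integrable M (\<lambda>x. (cmod (f x))\<^sup>2)" "integrable M f"
proof -
  show sq: "integrable M (\<lambda>x. (cmod (f x))\<^sup>2)"
    using assms by (intro integrableI_nonneg) auto
  show "integrable M f"
  proof (rule Bochner_Integration.integrable_bound)
    show "integrable M (\<lambda>x. 1 + (cmod (f x))\<^sup>2)" using sq by simp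
    have "cmod z \<le> 1 + (cmod z)\<^sup>2" for z
    proof -
      have "0 \<le> (cmod z - 1)\<^sup>2" by simp
      then have "2 * cmod z \<le> 1 + (cmod z)\<^sup>2" by (simp add: power2_diff)
      then show ?thesis using norm_ge_zero[of z] by linarith
    qed
    then show "AE x in M. cmod (f x) \<le> norm (1 + (cmod (f x))\<^sup>2)" by simp
  qed (use assms in measurable)
qed

text \<open>The sign is opposite to the usual one, so Fourier series run over
  \<open>char (- (l * x))\<close>. It is dictated by the Zak phase: passing from index
  \<open>k\<close> to \<open>k + q * l\<close> multiplies the integrand by
  \<open>char (l * x)\<close>.\<close>

definition fourier_coeff :: "(real \<Rightarrow> complex) \<Rightarrow> int \<Rightarrow> complex" where
  "fourier_coeff f l = (\<integral>x. f x * char (of_int l * x) \<partial>unit_lborel)"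

text \<open>Expanding the square leaves only the diagonal, by orthogonality of the characters. The
  crude uniform bound serves to make products of the sum with integrable functions
  integrable.\<close>

lemma nn_integral_trig_sum:
  assumes "finite L"
  shows "(\<integral>\<^sup>+x. ennreal ((cmod (\<Sum>l\<in>L. c l * char (- (of_int l * x))))\<^sup>2) \<partial>unit_lborel) =
    ennreal (\<Sum>l\<in>L. (cmod (c l))\<^sup>2)" (is "?lhs = _")
    and "\<And>x. cmod (\<Sum>l\<in>L. c l * char (- (of_int l * x))) \<le> (\<Sum>l\<in>L. cmod (c l))"
proof -
  define S where "S x = (\<Sum>l\<in>L. c l * char (- (of_int l * x)))" for x
  have [measurable]: "S \<in> borel_measurable borel" unfolding S_def by measurable
  show bd: "cmod (\<Sum>l\<in>L. c l * char (- (of_int l * x))) \<le> (\<Sum>l\<in>L. cmod (c l))" for x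
    by (rule order_trans[OF norm_sum]) (simp add: norm_mult)
  have int: "integrable unit_lborel (\<lambda>x. (cmod (S x))\<^sup>2)"
    by (rule unit.integrable_const_bound[where B = "(\<Sum>l\<in>L. cmod (c l))\<^sup>2"])
      (auto simp: S_def intro!: power_mono bd)
  have eq: "complex_of_real ((cmod (S x))\<^sup>2) =
      (\<Sum>l\<in>L. \<Sum>k\<in>L. c l * cnj (c k) * char (of_int (k - l) * x))" for x
  proof -
    have "complex_of_real ((cmod (S x))\<^sup>2) = S x * cnj (S x)"
      by (rule complex_norm_square)
    also have "\<dots> = (\<Sum>l\<in>L. \<Sum>k\<in>L. (c l * char (- (of_int l * x))) * (cnj (c k) * char (of_int k * x)))"
      by (simp add: S_def sum_product cnj_char)
    also have "\<dots> = (\<Sum>l\<in>L. \<Sum>k\<in>L. c l * cnj (c k) * char (of_int (k - l) * x))"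
    proof (intro sum.cong refl)
      fix l k
      have "char (of_int (k - l) * x) = char (- (of_int l * x)) * char (of_int k * x)"
        by (simp flip: char_add add: algebra_simps)
      then show "(c l * char (- (of_int l * x))) * (cnj (c k) * char (of_int k * x)) =
          c l * cnj (c k) * char (of_int (k - l) * x)" by simp
    qed
    finally show ?thesis .
  qed
  have int': "integrable unit_lborel (\<lambda>x. a * char (of_int l * x))" for a and l :: int
    by (rule unit.integrable_const_bound[where B = "cmod a"]) (auto simp: norm_mult)
  have "complex_of_real (\<integral>x. (cmod (S x))\<^sup>2 \<partial>unit_lborel) =
      (\<integral>x. (\<Sum>l\<in>L. \<Sum>k\<in>L. c l * cnj (c k) * char (of_int (k - l) * x)) \<partial>unit_lborel)"
    unfolding integral_complex_of_real[symmetric] eq ..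
  also have "\<dots> = (\<Sum>l\<in>L. \<Sum>k\<in>L. c l * cnj (c k) * (if k = l then 1 else 0))"
    using int' by (simp add: integral_char del: of_int_diff)
  also have "\<dots> = (\<Sum>l\<in>L. c l * cnj (c l))"
    using assms by (simp add: if_distrib cong: if_cong)
  also have "\<dots> = complex_of_real (\<Sum>l\<in>L. (cmod (c l))\<^sup>2)"
    by (simp only: of_real_sum complex_norm_square)
  finally have "(\<integral>x. (cmod (S x))\<^sup>2 \<partial>unit_lborel) = (\<Sum>l\<in>L. (cmod (c l))\<^sup>2)"
    by (simp only: of_real_eq_iff)
  then show "?lhs = ennreal (\<Sum>l\<in>L. (cmod (c l))\<^sup>2)"
    using nn_integral_eq_integral[OF int] by (simp add: S_def)
qed

text \<open>Kept as an identity with its remainder: dropping the remainder gives Bessel's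
  inequality, and letting it tend to 0 gives the norm of a Fourier series.\<close>

lemma bessel_identity:
  assumes f: "f \<in> borel_measurable unit_lborel" "(\<integral>\<^sup>+x. ennreal ((cmod (f x))\<^sup>2) \<partial>unit_lborel) < \<infinity>"
    and L: "finite L"
  shows "(\<integral>\<^sup>+x. ennreal ((cmod (f x))\<^sup>2) \<partial>unit_lborel) =
    (\<integral>\<^sup>+x. ennreal ((cmod (f x - (\<Sum>l\<in>L. fourier_coeff f l * char (- (of_int l * x)))))\<^sup>2) \<partial>unit_lborel)
    + ennreal (\<Sum>l\<in>L. (cmod (fourier_coeff f l))\<^sup>2)"
proof -
  note [measurable] = f(1)
  note fi = unit.square_integrable_imp_integrable_complex[OF f]
  define c where "c = fourier_coeff f"
  define S where "S x = (\<Sum>l\<in>L. c l * char (- (of_int l * x)))" for x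
  define N where "N = (\<Sum>l\<in>L. (cmod (c l))\<^sup>2)"
  define r where "r = (\<lambda>x. Re (f x * cnj (S x)))"
  have [measurable]: "S \<in> borel_measurable unit_lborel" unfolding S_def by measurable
  have bd: "cmod (S x) \<le> (\<Sum>l\<in>L. cmod (c l))" for x
    unfolding S_def by (rule nn_integral_trig_sum(2)[OF L])
  have S2: "integrable unit_lborel (\<lambda>x. (cmod (S x))\<^sup>2)"
    by (rule unit.integrable_const_bound[where B = "(\<Sum>l\<in>L. cmod (c l))\<^sup>2"])
      (auto intro!: power_mono bd)
  have N: "(\<integral>x. (cmod (S x))\<^sup>2 \<partial>unit_lborel) = N"
    using nn_integral_trig_sum(1)[OF L, of c] nn_integral_eq_integral[OF S2]
    by (simp add: S_def N_def sum_nonneg)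
  have fS: "integrable unit_lborel (\<lambda>x. f x * cnj (S x))"
    by (rule integrable_mult_bounded[OF fi(2)]) (use bd in auto)
  have "(\<integral>x. f x * cnj (S x) \<partial>unit_lborel) =
      (\<integral>x. (\<Sum>l\<in>L. cnj (c l) * (f x * char (of_int l * x))) \<partial>unit_lborel)"
    by (simp add: S_def sum_distrib_left cnj_char mult_ac)
  also have "\<dots> = (\<Sum>l\<in>L. cnj (c l) * c l)"
    by (subst Bochner_Integration.integral_sum)
      (auto simp: c_def fourier_coeff_def intro!: integrable_mult_bounded[OF fi(2), where B = 1]
        integrable_mult_right)
  also have "\<dots> = complex_of_real N"
    by (simp only: N_def of_real_sum complex_norm_square mult.commute)
  finally have "Re (\<integral>x. f x * cnj (S x) \<partial>unit_lborel) = N" by simp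
  then have R: "(\<integral>x. r x \<partial>unit_lborel) = N" and r: "integrable unit_lborel r"
    using integral_Re[OF fS] integrable_Re[OF fS] by (simp_all only: r_def)
  \<comment> \<open>\<open>S\<close> is the orthogonal projection of \<open>f\<close>, so the cross
    term \<open>r\<close> and the square of \<open>S\<close> both integrate to \<open>N\<close>; the
    expansion therefore integrates to the squared norm of \<open>f\<close> minus
    \<open>N\<close>.\<close>
  have exp: "(cmod (f x - S x))\<^sup>2 = (cmod (f x))\<^sup>2 - 2 * r x + (cmod (S x))\<^sup>2" for x
    unfolding cmod_power2 r_def by (simp add: power2_eq_square algebra_simps)
  have iD: "integrable unit_lborel (\<lambda>x. (cmod (f x - S x))\<^sup>2)"
    unfolding exp using fi(1) S2 r by simp
  have "(\<integral>x. (cmod (f x - S x))\<^sup>2 \<partial>unit_lborel) =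
      (\<integral>x. (cmod (f x))\<^sup>2 \<partial>unit_lborel) - 2 * (\<integral>x. r x \<partial>unit_lborel)
      + (\<integral>x. (cmod (S x))\<^sup>2 \<partial>unit_lborel)"
    unfolding exp using fi(1) S2 r by simp
  then have "(\<integral>x. (cmod (f x))\<^sup>2 \<partial>unit_lborel) = (\<integral>x. (cmod (f x - S x))\<^sup>2 \<partial>unit_lborel) + N"
    using R N by simp
  then have "ennreal (\<integral>x. (cmod (f x))\<^sup>2 \<partial>unit_lborel) =
      ennreal (\<integral>x. (cmod (f x - S x))\<^sup>2 \<partial>unit_lborel) + ennreal N"
    by (simp add: ennreal_plus[symmetric] N_def sum_nonneg del: ennreal_plus)
  then show ?thesis
    using nn_integral_eq_integral[OF fi(1)] nn_integral_eq_integral[OF iD]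
    by (simp add: S_def c_def N_def)
qed

section \<open>Uniqueness of Fourier coefficients\<close>

text \<open>Real polynomials in the coordinates of \<open>char x\<close> are trigonometric
  polynomials, against which \<open>g\<close> integrates to 0, and Stone-Weierstrass on the unit
  circle passes to continuous \<open>u\<close>. Working on the circle builds in the periodicity at
  the ends of the interval.\<close>

lemma integral_mult_continuous_char_eq_0:
  fixes g :: "real \<Rightarrow> complex" and u :: "complex \<Rightarrow> real"
  assumes g: "integrable unit_lborel g" and zero: "\<And>l. fourier_coeff g l = 0"
    and u: "continuous_on UNIV u"
  shows "(\<integral>x. g x * of_real (u (char x)) \<partial>unit_lborel) = 0"
proof -
  note [measurable] = borel_measurable_integrable[OF g]
  \<comment> \<open>Vanishing is demanded against every twist of \<open>\<psi>\<close> by a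
    character, so that multiplication by a character preserves \<open>A\<close>; boundedness keeps
    the products with \<open>g\<close> integrable.\<close>
  define A where "A = {\<psi>. \<psi> \<in> borel_measurable unit_lborel \<and> (\<exists>B. \<forall>x. cmod (\<psi> x) \<le> B) \<and>
    (\<forall>l. (\<integral>x. g x * (\<psi> x * char (of_int l * x)) \<partial>unit_lborel) = 0)}"
  have meas: "\<psi> \<in> borel_measurable unit_lborel" if "\<psi> \<in> A" for \<psi>
    using that by (simp add: A_def)
  have zeroA: "(\<integral>x. g x * (\<psi> x * char (of_int l * x)) \<partial>unit_lborel) = 0" if "\<psi> \<in> A" for \<psi> l
    using that by (simp add: A_def)
  have int: "integrable unit_lborel (\<lambda>x. g x * (\<psi> x * char (of_int l * x)))" if "\<psi> \<in> A" for \<psi> l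
  proof -
    obtain B where B: "\<forall>x. cmod (\<psi> x) \<le> B" using \<open>\<psi> \<in> A\<close> unfolding A_def by blast
    have [measurable]: "\<psi> \<in> borel_measurable unit_lborel" using that by (rule meas)
    show ?thesis
      by (rule integrable_mult_bounded[OF g, where B = B]) (auto simp: norm_mult B)
  qed
  have A_add: "(\<lambda>x. \<psi> x + \<phi> x) \<in> A" if "\<psi> \<in> A" "\<phi> \<in> A" for \<psi> \<phi>
  proof -
    obtain B C where B: "\<forall>x. cmod (\<psi> x) \<le> B" and C: "\<forall>x. cmod (\<phi> x) \<le> C"
      using \<open>\<psi> \<in> A\<close> \<open>\<phi> \<in> A\<close> unfolding A_def by blast
    have "cmod (\<psi> x + \<phi> x) \<le> B + C" for x
      using norm_triangle_ineq[of "\<psi> x" "\<phi> x"] B[rule_format, of x] C[rule_format, of x] by linarith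
    moreover have "(\<integral>x. g x * ((\<psi> x + \<phi> x) * char (of_int l * x)) \<partial>unit_lborel) = 0" for l
    proof -
      have "(\<integral>x. g x * ((\<psi> x + \<phi> x) * char (of_int l * x)) \<partial>unit_lborel) =
          (\<integral>x. g x * (\<psi> x * char (of_int l * x)) + g x * (\<phi> x * char (of_int l * x)) \<partial>unit_lborel)"
        by (simp only: distrib_left distrib_right)
      also have "\<dots> = (\<integral>x. g x * (\<psi> x * char (of_int l * x)) \<partial>unit_lborel) +
          (\<integral>x. g x * (\<phi> x * char (of_int l * x)) \<partial>unit_lborel)"
        using that by (intro Bochner_Integration.integral_add int)
      also have "\<dots> = 0" using that by (simp add: A_def)
      finally show ?thesis .
    qed
    moreover have "(\<lambda>x. \<psi> x + \<phi> x) \<in> borel_measurable unit_lborel"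
      using meas that by (intro borel_measurable_add) auto
    ultimately show ?thesis unfolding A_def by blast
  qed
  have scale: "(\<lambda>x. c * \<psi> x) \<in> A" if "\<psi> \<in> A" for c \<psi>
  proof -
    obtain B where "\<forall>x. cmod (\<psi> x) \<le> B" using \<open>\<psi> \<in> A\<close> unfolding A_def by blast
    then have "cmod (c * \<psi> x) \<le> cmod c * B" for x
      by (simp add: norm_mult mult_left_mono)
    moreover have "(\<integral>x. g x * (c * \<psi> x * char (of_int l * x)) \<partial>unit_lborel) = 0" for l
    proof -
      have "(\<integral>x. g x * (c * \<psi> x * char (of_int l * x)) \<partial>unit_lborel) =
          (\<integral>x. c * (g x * (\<psi> x * char (of_int l * x))) \<partial>unit_lborel)"
        by (simp add: mult_ac)
      also have "\<dots> = 0" using that by (simp add: A_def)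
      finally show ?thesis .
    qed
    moreover have "(\<lambda>x. c * \<psi> x) \<in> borel_measurable unit_lborel"
      using meas that by (intro borel_measurable_times borel_measurable_const) auto
    ultimately show ?thesis unfolding A_def by blast
  qed
  have shift: "(\<lambda>x. char (of_int k * x) * \<psi> x) \<in> A" if "\<psi> \<in> A" for k \<psi>
  proof -
    have "(\<integral>x. g x * (char (of_int k * x) * \<psi> x * char (of_int l * x)) \<partial>unit_lborel) = 0" for l
    proof -
      have eq: "g x * (char (of_int k * x) * \<psi> x * char (of_int l * x)) =
          g x * (\<psi> x * char (of_int (k + l) * x))" for x
        by (simp add: ring_distribs char_add)
      show ?thesis using that unfolding eq A_def by blast
    qed
    moreover have "(\<lambda>x. char (of_int k * x) * \<psi> x) \<in> borel_measurable unit_lborel"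
      using meas[OF that] by measurable
    moreover have "\<exists>B. \<forall>x. cmod (char (of_int k * x) * \<psi> x) \<le> B"
      using that by (simp add: A_def norm_mult)
    ultimately show ?thesis unfolding A_def by blast
  qed
  \<comment> \<open>The function \<open>\<psi>\<close> stays arbitrary in the induction: for a
    product of polynomials, one factor is applied to the member of \<open>A\<close> produced by the
    other.\<close>
  have poly: "(\<lambda>x. of_real (P (char x)) * \<psi> x) \<in> A"
    if "real_polynomial_function P" "\<psi> \<in> A" for P \<psi>
    using that
  proof (induction arbitrary: \<psi>)
    case (linear f)
    \<comment> \<open>A real-linear functional on the plane has the form
      \<open>c * z + cnj c * cnj z\<close>, which on the circle combines the characters of
      frequencies 1 and -1.\<close>
    define c where "c = (of_real (f 1) - \<i> * of_real (f \<i>)) / 2"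
    have f: "f z = Re z * f 1 + Im z * f \<i>" for z
    proof -
      interpret bounded_linear f by (rule linear)
      have "f (Re z *\<^sub>R 1 + Im z *\<^sub>R \<i>) = Re z * f 1 + Im z * f \<i>"
        by (simp only: add scaleR real_scaleR_def)
      moreover have "Re z *\<^sub>R 1 + Im z *\<^sub>R \<i> = z" by (simp add: complex_eq_iff)
      ultimately show ?thesis by simp
    qed
    have eq: "of_real (f (char x)) * \<psi> x =
        c * (char (of_int 1 * x) * \<psi> x) + cnj c * (char (of_int (- 1) * x) * \<psi> x)" for x
    proof -
      have "of_real (f (char x)) = c * char x + cnj c * cnj (char x)"
        by (subst f) (simp add: c_def complex_eq_iff add_divide_distrib diff_divide_distrib)
      then show ?thesis by (simp add: cnj_char ring_distribs)
    qed
    show ?case unfolding eq by (intro A_add scale shift linear)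
  next
    case (const c)
    show ?case by (intro scale const)
  next
    case (add f h)
    have "(\<lambda>x. of_real (f (char x)) * \<psi> x + of_real (h (char x)) * \<psi> x) \<in> A"
      by (intro A_add add)
    then show ?case by (simp only: of_real_add distrib_right)
  next
    case (mult f h)
    have "(\<lambda>x. of_real (f (char x)) * (of_real (h (char x)) * \<psi> x)) \<in> A"
      by (intro mult)
    then show ?case by (simp only: of_real_mult mult.assoc)
  qed
  have "(\<lambda>_. 1) \<in> A"
    using zero by (auto simp: A_def fourier_coeff_def intro!: exI[of _ 1])
  note poly1 = poly[OF _ this]
  have P0: "(\<integral>x. g x * of_real (P (char x)) \<partial>unit_lborel) = 0"
    and Pint: "integrable unit_lborel (\<lambda>x. g x * of_real (P (char x)))"
    if "real_polynomial_function P" for P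
  proof -
    show "(\<integral>x. g x * of_real (P (char x)) \<partial>unit_lborel) = 0"
      using zeroA[OF poly1[OF that], of 0] by simp
    show "integrable unit_lborel (\<lambda>x. g x * of_real (P (char x)))"
      using int[OF poly1[OF that], of 0] by simp
  qed
  have [measurable]: "u \<in> borel_measurable borel"
    using u by (rule borel_measurable_continuous_onI)
  have "compact (sphere (0::complex) 1)" by simp
  then have "compact (u ` sphere 0 1)"
    by (intro compact_continuous_image continuous_on_subset[OF u]) auto
  then have "bounded (u ` sphere 0 1)" by (rule compact_imp_bounded)
  then obtain B where B: "\<forall>z\<in>sphere 0 1. \<bar>u z\<bar> \<le> B"
    unfolding bounded_iff by auto
  have uint: "integrable unit_lborel (\<lambda>x. g x * of_real (u (char x)))"
    by (rule integrable_mult_bounded[OF g, where B = B]) (use B in auto)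
  have "cmod (\<integral>x. g x * of_real (u (char x)) \<partial>unit_lborel) \<le> 0 + e" if "e > 0" for e
  proof -
    define G where "G = (\<integral>x. cmod (g x) \<partial>unit_lborel)"
    have G: "G \<ge> 0" by (simp add: G_def)
    \<comment> \<open>The summand 1 guards against \<open>G = 0\<close>.\<close>
    have "0 < e / (G + 1)" using \<open>e > 0\<close> G by simp
    then obtain P where P: "real_polynomial_function P"
      and uP: "\<And>z. z \<in> sphere 0 1 \<Longrightarrow> \<bar>u z - P z\<bar> < e / (G + 1)"
      using Stone_Weierstrass_real_polynomial_function[OF \<open>compact (sphere (0::complex) 1)\<close>
          continuous_on_subset[OF u subset_UNIV]] by metis
    have "(\<integral>x. g x * of_real (u (char x)) \<partial>unit_lborel) =
        (\<integral>x. g x * of_real (u (char x)) - g x * of_real (P (char x)) \<partial>unit_lborel)"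
      using uint Pint[OF P] P0[OF P] by simp
    also have "cmod \<dots> \<le>
        (\<integral>x. cmod (g x * of_real (u (char x)) - g x * of_real (P (char x))) \<partial>unit_lborel)"
      by (rule integral_norm_bound)
    also have "\<dots> \<le> (\<integral>x. cmod (g x) * (e / (G + 1)) \<partial>unit_lborel)"
    proof (rule integral_mono)
      show "cmod (g x * of_real (u (char x)) - g x * of_real (P (char x))) \<le> cmod (g x) * (e / (G + 1))" for x
      proof -
        have "cmod (g x * of_real (u (char x)) - g x * of_real (P (char x))) =
            cmod (g x) * \<bar>u (char x) - P (char x)\<bar>"
          by (simp flip: right_diff_distrib of_real_diff add: norm_mult)
        also have "\<dots> \<le> cmod (g x) * (e / (G + 1))"
          using uP[of "char x"] by (intro mult_left_mono) auto
        finally show ?thesis .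
      qed
    qed (use uint Pint[OF P] g in auto)
    also have "\<dots> = G * (e / (G + 1))" by (simp add: G_def)
    also have "\<dots> \<le> e" using G that by (simp add: field_simps)
    finally show ?thesis by simp
  qed
  then have "cmod (\<integral>x. g x * of_real (u (char x)) \<partial>unit_lborel) \<le> 0"
    by (rule field_le_epsilon)
  then show ?thesis by simp
qed

text \<open>The image of \<open>K\<close> on the circle is compact, so its indicator is a bounded
  pointwise limit of the continuous tents \<open>u n\<close>. Injectivity of \<open>char\<close> on
  [0,1) identifies this indicator with that of \<open>K\<close>.\<close>

lemma integral_mult_indicator_compact_eq_0:
  fixes g :: "real \<Rightarrow> complex"
  assumes g: "integrable unit_lborel g" and zero: "\<And>l. fourier_coeff g l = 0"
    and K: "compact K" "K \<subseteq> {0..<1}"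
  shows "(\<integral>x. g x * indicator K x \<partial>unit_lborel) = 0"
\<comment> \<open>\<open>infdist\<close> to the empty set is 0 by convention, so for empty
  \<open>K\<close> the tents would be constantly 1 and would not tend to the indicator.\<close>
proof (cases "K = {}")
  case False
  note [measurable] = borel_measurable_integrable[OF g]
  define C where "C = char ` K"
  have "compact C"
    unfolding C_def using K by (intro compact_continuous_image continuous_intros)
  then have C: "closed C" by (rule compact_imp_closed)
  define u where "u n z = max 0 (1 - real n * infdist z C)" for n z
  have u_cont: "continuous_on UNIV (u n)" for n
    unfolding u_def by (intro continuous_intros)
  have [measurable]: "u n \<in> borel_measurable borel" for n
    by (rule borel_measurable_continuous_onI[OF u_cont])
  have [measurable]: "C \<in> sets borel" using C by (rule borel_closed)
  have lim: "(\<lambda>n. u n z) \<longlonglongrightarrow> indicator C z" for z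
  proof (cases "z \<in> C")
    case True
    then show ?thesis by (simp add: u_def)
  next
    case False
    then have pos: "infdist z C > 0"
      using in_closed_iff_infdist_zero[OF C, of z] infdist_nonneg[of z C] \<open>K \<noteq> {}\<close> by (auto simp: C_def less_le)
    have "eventually (\<lambda>n. 1 / infdist z C \<le> real n) sequentially"
      using eventually_ge_at_top[of "nat \<lceil>1 / infdist z C\<rceil>"]
      by eventually_elim linarith
    then have "eventually (\<lambda>n. u n z = 0) sequentially"
      by eventually_elim (use pos in \<open>simp add: u_def field_simps\<close>)
    then show ?thesis using False by (simp add: tendsto_eventually)
  qed
  have "(\<lambda>n. \<integral>x. g x * of_real (u n (char x)) \<partial>unit_lborel) \<longlonglongrightarrow>
      (\<integral>x. g x * of_real (indicator C (char x)) \<partial>unit_lborel)"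
  proof (rule integral_dominated_convergence)
    show "integrable unit_lborel (\<lambda>x. cmod (g x))" using g by simp
    show "AE x in unit_lborel. (\<lambda>n. g x * of_real (u n (char x))) \<longlonglongrightarrow> g x * of_real (indicator C (char x))"
      by (intro AE_I2 tendsto_intros lim)
    have "\<bar>u n z\<bar> \<le> 1" for n z by (simp add: u_def infdist_nonneg)
    then show "AE x in unit_lborel. cmod (g x * of_real (u n (char x))) \<le> cmod (g x)" for n
      by (simp add: norm_mult mult_left_le)
  qed measurable
  moreover have "(\<integral>x. g x * of_real (u n (char x)) \<partial>unit_lborel) = 0" for n
    by (rule integral_mult_continuous_char_eq_0[OF g zero u_cont])
  ultimately have "(\<integral>x. g x * of_real (indicator C (char x)) \<partial>unit_lborel) = 0"
    by (simp add: LIMSEQ_const_iff)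
  also have "(\<integral>x. g x * of_real (indicator C (char x)) \<partial>unit_lborel) =
      (\<integral>x. g x * indicator K x \<partial>unit_lborel)"
  proof (intro Bochner_Integration.integral_cong refl)
    fix x assume "x \<in> space unit_lborel"
    then have x: "x \<in> {0..<1}" by (simp only: space_unit_lborel)
    have "x \<in> K" if "char x \<in> C"
    proof -
      from that obtain y where "y \<in> K" "char x = char y" unfolding C_def by blast
      moreover have "x = y"
        using x \<open>y \<in> K\<close> K(2) \<open>char x = char y\<close> by (intro char_inj) auto
      ultimately show ?thesis by simp
    qed
    then have "char x \<in> C \<longleftrightarrow> x \<in> K" unfolding C_def by blast
    then show "g x * of_real (indicator C (char x)) = g x * indicator K x"
      by (simp add: indicator_def)
  qed
  finally show ?thesis .
qed simp

text \<open>Inner regularity exhausts the set where \<open>h\<close> is positive, up to measure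
  \<open>e\<close>, by a closed set, which is compact since it lies in [0,1). There \<open>h\<close>
  is positive with integral 0, so this closed set is null, and the whole set has measure at most
  \<open>e\<close>.\<close>

lemma AE_nonpos_if_integral_compact_eq_0:
  fixes h :: "real \<Rightarrow> real"
  assumes h: "integrable unit_lborel h"
    and zero: "\<And>K. compact K \<Longrightarrow> K \<subseteq> {0..<1} \<Longrightarrow> (\<integral>x. h x * indicator K x \<partial>unit_lborel) = 0"
  shows "AE x in unit_lborel. h x \<le> 0"
proof -
  define S where "S = {x \<in> space unit_lborel. 0 < h x}"
  have S_unit: "S \<in> sets unit_lborel"
    using borel_measurable_integrable[OF h] unfolding S_def by measurable
  then have S: "S \<in> sets borel" by (auto simp: sets_restrict_space)
  have small: "emeasure lborel S \<le> 0 + ennreal e" if "e > 0" for e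
  proof -
    have "S \<in> sets lebesgue" using S by simp
    then obtain T where T: "closed T" "T \<subseteq> S" "emeasure lebesgue (S - T) < ennreal e"
      using sets_lebesgue_inner_closed[OF _ \<open>0 < e\<close>] by metis
    have T01: "T \<subseteq> {0..<1}" using T(2) by (auto simp: S_def space_unit_lborel)
    then have "bounded T" by (rule bounded_subset[rotated]) simp
    then have "compact T" using T(1) by (simp add: compact_eq_bounded_closed)
    have Tb [measurable]: "T \<in> sets borel" using T(1) by (rule borel_closed)
    have Tu: "T \<in> sets unit_lborel" using T01 Tb by (auto simp: sets_restrict_space)
    have "integrable unit_lborel (\<lambda>x. h x * indicator T x)"
      using integrable_mult_indicator[OF Tu h] by (simp add: mult.commute)
    moreover have "0 \<le> h x * indicator T x" for x
      using T(2) by (auto simp: S_def indicator_def less_imp_le)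
    ultimately have "AE x in unit_lborel. h x * indicator T x = 0"
      using zero[OF \<open>compact T\<close> T01] by (subst (asm) integral_nonneg_eq_0_iff_AE) auto
    then have "AE x in unit_lborel. x \<notin> T"
      by eventually_elim (use T(2) in \<open>auto simp: S_def indicator_def split: if_splits\<close>)
    then have "AE x in lborel. x \<notin> T"
      unfolding AE_unit_lborel by eventually_elim (use T01 in auto)
    then have "emeasure lborel T = 0"
      using AE_iff_measurable[of T lborel "\<lambda>x. x \<notin> T"] Tb by auto
    then have "emeasure lborel S \<le> emeasure lborel (S - T)"
      using emeasure_subadditive[of T lborel "S - T"] Tb S T(2) by (simp add: Un_absorb1)
    also have "\<dots> \<le> ennreal e" using T(3) S Tb by (simp add: emeasure_completion[symmetric])
    finally show ?thesis by simp
  qed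
  have "emeasure lborel S \<le> 0"
    by (rule ennreal_le_epsilon) (rule small)
  then have "AE x in lborel. x \<notin> S"
    using S by (intro AE_not_in) (auto simp: null_sets_def)
  then show ?thesis
    unfolding AE_unit_lborel by eventually_elim (auto simp: S_def space_unit_lborel)
qed

lemma fourier_coeff_eq_0_imp_AE_0:
  assumes g: "integrable unit_lborel g" and zero: "\<And>l. fourier_coeff g l = 0"
  shows "AE x in unit_lborel. g x = 0"
proof -
  have *: "(\<integral>x. Re (g x) * indicator K x \<partial>unit_lborel) = 0"
    "(\<integral>x. Im (g x) * indicator K x \<partial>unit_lborel) = 0"
    if K: "compact K" "K \<subseteq> {0..<1}" for K
  proof -
    have "K \<in> sets unit_lborel"
      using K by (auto simp: sets_restrict_space intro!: borel_compact image_eqI[of _ _ K])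
    from integrable_mult_indicator[OF this g]
    have "integrable unit_lborel (\<lambda>x. indicator K x *\<^sub>R g x)" .
    moreover have "indicator K x *\<^sub>R g x = g x * indicator K x" for x
      by (simp add: indicator_def)
    ultimately have i: "integrable unit_lborel (\<lambda>x. g x * indicator K x)"
      by simp
    have "Re (g x * indicator K x) = Re (g x) * indicator K x"
      "Im (g x * indicator K x) = Im (g x) * indicator K x" for x
      by (auto simp: indicator_def)
    then show "(\<integral>x. Re (g x) * indicator K x \<partial>unit_lborel) = 0"
      "(\<integral>x. Im (g x) * indicator K x \<partial>unit_lborel) = 0"
      using integral_Re[OF i] integral_Im[OF i] integral_mult_indicator_compact_eq_0[OF g zero K]
      by auto
  qed
  have "AE x in unit_lborel. Re (g x) \<le> 0" "AE x in unit_lborel. - Re (g x) \<le> 0"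
    "AE x in unit_lborel. Im (g x) \<le> 0" "AE x in unit_lborel. - Im (g x) \<le> 0"
    by (rule AE_nonpos_if_integral_compact_eq_0; use g * in simp)+
  then show ?thesis
    by eventually_elim (simp add: complex_eq_iff)
qed

section \<open>Completeness of square-integrable functions\<close>

text \<open>A rapidly Cauchy subsequence converges almost everywhere, and Fatou's lemma turns the
  Cauchy bound into a bound on the distance to its limit.\<close>

lemma square_integrable_complete:
  fixes S :: "nat \<Rightarrow> 'a \<Rightarrow> complex"
  assumes meas [measurable]: "\<And>n. S n \<in> borel_measurable M"
    and cauchy: "\<And>e. e > 0 \<Longrightarrow>
      \<exists>N. \<forall>i\<ge>N. \<forall>j\<ge>N. (\<integral>\<^sup>+x. ennreal ((cmod (S i x - S j x))\<^sup>2) \<partial>M) \<le> ennreal e"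
  obtains g where "g \<in> borel_measurable M"
    and "\<And>e. e > 0 \<Longrightarrow> \<exists>N. \<forall>i\<ge>N. (\<integral>\<^sup>+x. ennreal ((cmod (S i x - g x))\<^sup>2) \<partial>M) \<le> ennreal e"
proof -
  have "\<exists>N. \<forall>i\<ge>N. \<forall>j\<ge>N.
      (\<integral>\<^sup>+x. ennreal ((cmod (S i x - S j x))\<^sup>2) \<partial>M) \<le> ennreal ((1/4) ^ k)" for k
    by (rule cauchy) simp
  then obtain N where N: "\<And>k. \<forall>i\<ge>N k. \<forall>j\<ge>N k.
      (\<integral>\<^sup>+x. ennreal ((cmod (S i x - S j x))\<^sup>2) \<partial>M) \<le> ennreal ((1/4) ^ k)"
    by (rule that[OF someI_ex])
  \<comment> \<open>Summing the thresholds puts both \<open>r k\<close> and \<open>r (Suc k)\<close>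
    beyond \<open>N k\<close>; the summand \<open>k\<close> forces \<open>r\<close> to infinity, as
    the passage to the limit by Fatou requires.\<close>
  define r where "r k = k + (\<Sum>i\<le>k. N i)" for k
  have rN: "r k \<ge> N k" "r (Suc k) \<ge> N k" for k
    by (simp_all add: r_def trans_le_add2 flip: lessThan_Suc_atMost)
  define d where "d k x = S (r (Suc k)) x - S (r k) x" for k x
  have [measurable]: "d k \<in> borel_measurable M" for k
    unfolding d_def by measurable
  \<comment> \<open>Increments with squared norm at most \<open>(1/4)^k\<close> survive the weights
    \<open>2^k\<close> and leave a geometric series with sum 2.\<close>
  have "(\<integral>\<^sup>+x. (\<Sum>k. ennreal (2 ^ k * (cmod (d k x))\<^sup>2)) \<partial>M) =
      (\<Sum>k. \<integral>\<^sup>+x. ennreal (2 ^ k * (cmod (d k x))\<^sup>2) \<partial>M)"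
    by (intro nn_integral_suminf) measurable
  also have "\<dots> \<le> (\<Sum>k. ennreal ((1/2) ^ k))"
  proof (intro suminf_le summableI)
    fix k
    have "(\<integral>\<^sup>+x. ennreal (2 ^ k * (cmod (d k x))\<^sup>2) \<partial>M) =
        ennreal (2 ^ k) * (\<integral>\<^sup>+x. ennreal ((cmod (d k x))\<^sup>2) \<partial>M)"
      by (simp add: ennreal_mult nn_integral_cmult)
    also have "\<dots> \<le> ennreal (2 ^ k) * ennreal ((1/4) ^ k)"
      unfolding d_def by (intro mult_left_mono N[rule_format] rN) auto
    also have "\<dots> = ennreal ((1/2) ^ k)"
      by (simp flip: ennreal_mult power_mult_distrib)
    finally show "(\<integral>\<^sup>+x. ennreal (2 ^ k * (cmod (d k x))\<^sup>2) \<partial>M) \<le> ennreal ((1/2) ^ k)" .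
  qed
  also have "\<dots> = ennreal 2"
    by (subst suminf_ennreal2) (auto simp: suminf_geometric summable_geometric)
  finally have "(\<integral>\<^sup>+x. (\<Sum>k. ennreal (2 ^ k * (cmod (d k x))\<^sup>2)) \<partial>M) \<noteq> \<infinity>"
    using le_less_trans[OF _ ennreal_less_top[of 2]] by fastforce
  then have "AE x in M. (\<Sum>k. ennreal (2 ^ k * (cmod (d k x))\<^sup>2)) \<noteq> \<infinity>"
    by (intro nn_integral_noteq_infinite) auto
  then have conv: "AE x in M. convergent (\<lambda>k. S (r k) x)"
  proof eventually_elim
    case (elim x)
    have "summable (\<lambda>k. 2 ^ k * (cmod (d k x))\<^sup>2)"
      using elim by (intro summable_suminf_not_top) auto
    then have "summable (\<lambda>k. 2 ^ k * (cmod (d k x))\<^sup>2 + (1/2) ^ k)"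
      by (intro summable_add summable_geometric) auto
    \<comment> \<open>From \<open>(a * |d| - 1)^2 >= 0\<close> with \<open>a = 2^k\<close>. It
      converts the weighted square summability at the point \<open>x\<close> into absolute
      summability of the increments.\<close>
    moreover have "cmod (d k x) \<le> 2 ^ k * (cmod (d k x))\<^sup>2 + (1/2) ^ k" for k
    proof -
      define a :: real where "a = 2 ^ k"
      have a: "a > 0" by (simp add: a_def)
      have "0 \<le> (a * cmod (d k x) - 1)\<^sup>2 / a" using a by simp
      also have "\<dots> = a * (cmod (d k x))\<^sup>2 + 1 / a - 2 * cmod (d k x)"
        using a by (simp add: power2_eq_square field_simps)
      finally have "cmod (d k x) \<le> a * (cmod (d k x))\<^sup>2 + 1 / a"
        using norm_ge_zero[of "d k x"] by linarith
      then show ?thesis by (simp add: a_def power_one_over)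
    qed
    ultimately have "summable (\<lambda>k. d k x)"
      by (rule summable_comparison_test'[where N = 0])
    then have "convergent (\<lambda>n. \<Sum>k<n. d k x)"
      by (simp add: summable_iff_convergent)
    then have "convergent (\<lambda>n. (\<Sum>k<n. d k x) + S (r 0) x)"
      by (intro convergent_add convergent_const)
    then show ?case
      by (simp add: d_def sum_lessThan_telescope[of "\<lambda>k. S (r k) x"])
  qed
  define g where "g x = lim (\<lambda>k. S (r k) x)" for x
  have g [measurable]: "g \<in> borel_measurable M"
    unfolding g_def by measurable
  show ?thesis
  proof (rule that[OF g])
    fix e :: real assume "e > 0"
    from cauchy[OF this] obtain N' where N': "\<forall>i\<ge>N'. \<forall>j\<ge>N'.
      (\<integral>\<^sup>+x. ennreal ((cmod (S i x - S j x))\<^sup>2) \<partial>M) \<le> ennreal e" ..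
    have "(\<integral>\<^sup>+x. ennreal ((cmod (S i x - g x))\<^sup>2) \<partial>M) \<le> ennreal e" if "i \<ge> N'" for i
    proof -
      have "(\<integral>\<^sup>+x. ennreal ((cmod (S i x - g x))\<^sup>2) \<partial>M) =
          (\<integral>\<^sup>+x. liminf (\<lambda>k. ennreal ((cmod (S i x - S (r k) x))\<^sup>2)) \<partial>M)"
      proof (rule nn_integral_cong_AE, use conv in eventually_elim)
        case (elim x)
        then have "(\<lambda>k. S (r k) x) \<longlonglongrightarrow> g x"
          by (simp add: g_def convergent_LIMSEQ_iff)
        then have "(\<lambda>k. ennreal ((cmod (S i x - S (r k) x))\<^sup>2)) \<longlonglongrightarrow> ennreal ((cmod (S i x - g x))\<^sup>2)"
          by (intro tendsto_ennrealI tendsto_intros)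
        then show ?case
          by (rule lim_imp_Liminf[OF sequentially_bot, symmetric])
      qed
      also have "\<dots> \<le> liminf (\<lambda>k. \<integral>\<^sup>+x. ennreal ((cmod (S i x - S (r k) x))\<^sup>2) \<partial>M)"
        by (rule nn_integral_liminf) measurable
      also have "\<dots> \<le> liminf (\<lambda>k. ennreal e)"
      proof (rule Liminf_mono)
        show "\<forall>\<^sub>F k in sequentially. (\<integral>\<^sup>+x. ennreal ((cmod (S i x - S (r k) x))\<^sup>2) \<partial>M) \<le> ennreal e"
          using eventually_ge_at_top[of N']
          by eventually_elim (rule N'[rule_format, OF that], simp add: r_def)
      qed
      also have "\<dots> = ennreal e" by (simp add: Liminf_const)
      finally show ?thesis .
    qed
    then show "\<exists>N. \<forall>i\<ge>N. (\<integral>\<^sup>+x. ennreal ((cmod (S i x - g x))\<^sup>2) \<partial>M) \<le> ennreal e"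
      by blast
  qed
qed

section \<open>Partial Fourier series on the unit square\<close>

abbreviation unit2_lborel :: "(real \<times> real) measure" where
  "unit2_lborel \<equiv> unit_lborel \<Otimes>\<^sub>M unit_lborel"

lemma borel_measurable_pair_unit_lborel [measurable (raw)]:
  "(\<lambda>z. snd z) \<in> borel_measurable (M \<Otimes>\<^sub>M unit_lborel)"
  "(\<lambda>z. fst z) \<in> borel_measurable (unit_lborel \<Otimes>\<^sub>M M)"
  by (rule measurable_compose[OF measurable_snd measurable_ident_unit_lborel]
      measurable_compose[OF measurable_fst measurable_ident_unit_lborel])+

text \<open>The squared norm lives in \<open>ennreal\<close>, so that Tonelli and countable sums
  apply unconditionally and finiteness becomes a separate condition.\<close>

definition l2sq :: "'a measure \<Rightarrow> ('a \<Rightarrow> complex) \<Rightarrow> ennreal" where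
  "l2sq M f = (\<integral>\<^sup>+x. ennreal ((cmod (f x))\<^sup>2) \<partial>M)"

lemma l2sq_cong_AE: "AE x in M. f x = g x \<Longrightarrow> l2sq M f = l2sq M g"
  unfolding l2sq_def by (rule nn_integral_cong_AE) auto

lemma l2sq_eq_0_iff:
  assumes "f \<in> borel_measurable M"
  shows "l2sq M f = 0 \<longleftrightarrow> (AE x in M. f x = 0)"
  unfolding l2sq_def using assms by (subst nn_integral_0_iff_AE) auto

lemma cmod_add_power2_le: "(cmod (a + b))\<^sup>2 \<le> 2 * (cmod a)\<^sup>2 + 2 * (cmod b)\<^sup>2"
proof -
  have "(cmod (a + b))\<^sup>2 \<le> (cmod a + cmod b)\<^sup>2"
    by (intro power_mono norm_triangle_ineq) auto
  also have "\<dots> \<le> 2 * (cmod a)\<^sup>2 + 2 * (cmod b)\<^sup>2"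
    using sum_squares_bound[of "cmod a" "cmod b"] by (simp add: power2_sum)
  finally show ?thesis .
qed

lemma l2sq_add_finite:
  assumes [measurable]: "f \<in> borel_measurable M" "g \<in> borel_measurable M"
    and fin: "l2sq M f < \<infinity>" "l2sq M g < \<infinity>"
  shows "l2sq M (\<lambda>x. f x + g x) < \<infinity>"
proof -
  have "l2sq M (\<lambda>x. f x + g x) \<le>
      (\<integral>\<^sup>+x. 2 * ennreal ((cmod (f x))\<^sup>2) + 2 * ennreal ((cmod (g x))\<^sup>2) \<partial>M)"
    unfolding l2sq_def
  proof (rule nn_integral_mono)
    fix x
    have "ennreal ((cmod (f x + g x))\<^sup>2) \<le> ennreal (2 * (cmod (f x))\<^sup>2 + 2 * (cmod (g x))\<^sup>2)"
      by (intro ennreal_leI cmod_add_power2_le)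
    then show "ennreal ((cmod (f x + g x))\<^sup>2) \<le> 2 * ennreal ((cmod (f x))\<^sup>2) + 2 * ennreal ((cmod (g x))\<^sup>2)"
      by (simp add: ennreal_plus ennreal_mult)
  qed
  also have "\<dots> = 2 * l2sq M f + 2 * l2sq M g"
    by (simp add: l2sq_def nn_integral_add nn_integral_cmult)
  also have "\<dots> < \<infinity>" using fin by (simp add: ennreal_mult_less_top)
  finally show ?thesis .
qed

lemma l2sq_minus: "l2sq M (\<lambda>x. f x - g x) = l2sq M (\<lambda>x. g x - f x)"
  by (simp add: l2sq_def norm_minus_commute)

lemma l2sq_diff_finite:
  assumes "f \<in> borel_measurable M" "g \<in> borel_measurable M"
    and fin: "l2sq M f < \<infinity>" "l2sq M g < \<infinity>"
  shows "l2sq M (\<lambda>x. f x - g x) < \<infinity>"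
  using l2sq_add_finite[of f M "\<lambda>x. - g x"] assms by (simp add: l2sq_def)

lemma l2sq_cmult: "f \<in> borel_measurable M \<Longrightarrow> l2sq M (\<lambda>x. c * f x) = ennreal ((cmod c)\<^sup>2) * l2sq M f"
  by (simp add: l2sq_def norm_mult power_mult_distrib ennreal_mult nn_integral_cmult)

lemma l2sq_unit2:
  assumes "g \<in> borel_measurable unit2_lborel"
  shows "l2sq unit2_lborel g = (\<integral>\<^sup>+t. l2sq unit_lborel (\<lambda>x. g (t, x)) \<partial>unit_lborel)"
  unfolding l2sq_def using assms by (subst unit.nn_integral_fst[symmetric]) auto

lemma AE_l2sq_section_finite:
  assumes [measurable]: "g \<in> borel_measurable unit2_lborel" and "l2sq unit2_lborel g < \<infinity>"
  shows "AE t in unit_lborel. l2sq unit_lborel (\<lambda>x. g (t, x)) < \<infinity>"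
proof -
  have "(\<lambda>t. l2sq unit_lborel (\<lambda>x. g (t, x))) \<in> borel_measurable unit_lborel"
    unfolding l2sq_def by measurable
  then have "AE t in unit_lborel. l2sq unit_lborel (\<lambda>x. g (t, x)) \<noteq> \<infinity>"
    using assms(2) by (intro nn_integral_noteq_infinite) (auto simp: l2sq_unit2)
  then show ?thesis by eventually_elim (simp add: less_top)
qed

lemma measurable_unit2_section:
  assumes [measurable]: "g \<in> borel_measurable unit2_lborel" and t: "t \<in> space unit_lborel"
  shows "(\<lambda>x. g (t, x)) \<in> borel_measurable unit_lborel"
  using t by measurable

lemma AE_section_integrable:
  assumes "g \<in> borel_measurable unit2_lborel" and "l2sq unit2_lborel g < \<infinity>"
  shows "AE t in unit_lborel. integrable unit_lborel (\<lambda>x. g (t, x))"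
  using AE_l2sq_section_finite[OF assms] AE_space
proof eventually_elim
  case (elim t)
  show ?case
  proof (rule unit.square_integrable_imp_integrable_complex(2))
    show "(\<lambda>x. g (t, x)) \<in> borel_measurable unit_lborel"
      using assms(1) elim(2) by (rule measurable_unit2_section)
    show "(\<integral>\<^sup>+x. ennreal ((cmod (g (t, x)))\<^sup>2) \<partial>unit_lborel) < \<infinity>"
      using elim(1) by (simp only: l2sq_def)
  qed
qed

lemma borel_measurable_fourier_coeff [measurable]:
  assumes [measurable]: "g \<in> borel_measurable unit2_lborel"
  shows "(\<lambda>t. fourier_coeff (\<lambda>x. g (t, x)) l) \<in> borel_measurable unit_lborel"
  unfolding fourier_coeff_def by measurable

lemma fourier_coeff_diff:
  assumes "integrable unit_lborel f" "integrable unit_lborel g"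
  shows "fourier_coeff (\<lambda>x. f x - g x) l = fourier_coeff f l - fourier_coeff g l"
  unfolding fourier_coeff_def using assms
  by (simp add: left_diff_distrib integrable_mult_bounded[where B = 1])

lemma fourier_coeff_trig_sum:
  assumes "finite L"
  shows "fourier_coeff (\<lambda>x. \<Sum>l\<in>L. c l * char (- (of_int l * x))) k = (if k \<in> L then c k else 0)"
proof -
  have int: "integrable unit_lborel (\<lambda>x. c l * char (of_int (k - l) * x))" for l
    by (rule unit.integrable_const_bound[where B = "cmod (c l)"]) (auto simp: norm_mult)
  have eq: "(\<Sum>l\<in>L. c l * char (- (of_int l * x))) * char (of_int k * x) =
      (\<Sum>l\<in>L. c l * char (of_int (k - l) * x))" for x
  proof -
    have "char (of_int (k - l) * x) = char (- (of_int l * x)) * char (of_int k * x)" for l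
      by (simp add: char_add[symmetric] algebra_simps)
    then show ?thesis by (simp add: sum_distrib_right mult.assoc del: of_int_diff)
  qed
  have "fourier_coeff (\<lambda>x. \<Sum>l\<in>L. c l * char (- (of_int l * x))) k =
      (\<Sum>l\<in>L. c l * (if k - l = 0 then 1 else 0))"
    unfolding fourier_coeff_def eq using int by (simp add: integral_char del: of_int_diff)
  also have "\<dots> = (if k \<in> L then c k else 0)"
    using assms by (simp add: if_distrib cong: if_cong)
  finally show ?thesis .
qed

text \<open>Bessel's identity in the second variable, integrated over the first. It applies to
  almost every section, because almost every section of a square-integrable function is square
  integrable.\<close>

lemma bessel_identity_unit2:
  assumes g [measurable]: "g \<in> borel_measurable unit2_lborel" and fin: "l2sq unit2_lborel g < \<infinity>"
    and L: "finite L"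
  shows "l2sq unit2_lborel g =
    l2sq unit2_lborel (\<lambda>(t, x). g (t, x) -
      (\<Sum>l\<in>L. fourier_coeff (\<lambda>x. g (t, x)) l * char (- (of_int l * x)))) +
    (\<Sum>l\<in>L. l2sq unit_lborel (\<lambda>t. fourier_coeff (\<lambda>x. g (t, x)) l))"
proof -
  define c where "c l t = fourier_coeff (\<lambda>x. g (t, x)) l" for l t
  have [measurable]: "c l \<in> borel_measurable unit_lborel" for l
    unfolding c_def by measurable
  define h where "h = (\<lambda>(t, x). g (t, x) - (\<Sum>l\<in>L. c l t * char (- (of_int l * x))))"
  have h [measurable]: "h \<in> borel_measurable unit2_lborel"
    unfolding h_def by measurable
  have "l2sq unit2_lborel g = (\<integral>\<^sup>+t. l2sq unit_lborel (\<lambda>x. g (t, x)) \<partial>unit_lborel)"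
    by (rule l2sq_unit2[OF g])
  also have "\<dots> = (\<integral>\<^sup>+t. l2sq unit_lborel (\<lambda>x. h (t, x)) + (\<Sum>l\<in>L. ennreal ((cmod (c l t))\<^sup>2)) \<partial>unit_lborel)"
  proof (rule nn_integral_cong_AE, use AE_l2sq_section_finite[OF g fin] AE_space in eventually_elim)
    case (elim t)
    then show ?case
      using bessel_identity[OF measurable_unit2_section[OF g] _ L, of t]
      by (simp add: l2sq_def h_def c_def sum_ennreal)
  qed
  also have "\<dots> = (\<integral>\<^sup>+t. l2sq unit_lborel (\<lambda>x. h (t, x)) \<partial>unit_lborel) +
      (\<Sum>l\<in>L. l2sq unit_lborel (c l))"
    unfolding l2sq_def by (subst nn_integral_add) (auto simp: nn_integral_sum simp del: sum_ennreal)
  also have "(\<integral>\<^sup>+t. l2sq unit_lborel (\<lambda>x. h (t, x)) \<partial>unit_lborel) = l2sq unit2_lborel h"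
    by (rule l2sq_unit2[OF h, symmetric])
  finally show ?thesis by (simp add: h_def c_def[abs_def])
qed

lemma l2sq_trig_sum_unit2:
  assumes L: "finite L" and [measurable]: "\<And>l. c l \<in> borel_measurable unit_lborel"
  shows "l2sq unit2_lborel (\<lambda>(t, x). \<Sum>l\<in>L. c l t * char (- (of_int l * x))) =
    (\<Sum>l\<in>L. l2sq unit_lborel (c l))"
proof -
  have "l2sq unit2_lborel (\<lambda>(t, x). \<Sum>l\<in>L. c l t * char (- (of_int l * x))) =
      (\<integral>\<^sup>+t. l2sq unit_lborel (\<lambda>x. \<Sum>l\<in>L. c l t * char (- (of_int l * x))) \<partial>unit_lborel)"
    by (subst l2sq_unit2) auto
  also have "\<dots> = (\<integral>\<^sup>+t. (\<Sum>l\<in>L. ennreal ((cmod (c l t))\<^sup>2)) \<partial>unit_lborel)"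
    using nn_integral_trig_sum(1)[OF L] by (simp add: l2sq_def sum_ennreal)
  also have "\<dots> = (\<Sum>l\<in>L. l2sq unit_lborel (c l))"
    unfolding l2sq_def by (subst nn_integral_sum) auto
  finally show ?thesis .
qed

text \<open>By orthogonality, a block of the Fourier series has as its squared norm a block of the
  convergent series of the \<open>\<beta> n\<close>, so the partial sums are Cauchy in mean. The
  norm of the limit comes from Bessel's identity, whose remainder tends to 0.\<close>

lemma riesz_fischer_unit2:
  fixes c :: "int \<Rightarrow> real \<Rightarrow> complex"
  assumes c [measurable]: "\<And>l. c l \<in> borel_measurable unit_lborel"
    and fin: "(\<integral>\<^sup>+l. l2sq unit_lborel (c l) \<partial>count_space UNIV) < \<infinity>"
  obtains g where "g \<in> borel_measurable unit2_lborel"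
    and "l2sq unit2_lborel g = (\<integral>\<^sup>+l. l2sq unit_lborel (c l) \<partial>count_space UNIV)"
    and "\<And>l. AE t in unit_lborel. fourier_coeff (\<lambda>x. g (t, x)) l = c l t"
proof -
  define b where "b n = l2sq unit_lborel (c (int_decode n))" for n
  have inj: "inj_on int_decode A" for A
    by (rule inj_int_decode)
  have sum_b: "(\<Sum>n. b n) = (\<integral>\<^sup>+l. l2sq unit_lborel (c l) \<partial>count_space UNIV)"
    using nn_integral_bij_count_space[OF bij_int_decode, of "\<lambda>l. l2sq unit_lborel (c l)"]
    by (simp add: b_def nn_integral_count_space_nat)
  define \<beta> where "\<beta> n = enn2real (b n)" for n
  have "b n < \<infinity>" for n
    using fin sum_b ennreal_suminf_lessD[of b \<infinity> n] by simp
  then have \<beta>: "b n = ennreal (\<beta> n)" "\<beta> n \<ge> 0" for n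
    by (auto simp: \<beta>_def less_top)
  have "summable \<beta>"
    using fin sum_b \<beta> by (intro summable_suminf_not_top) auto
  define S where "S N = (\<lambda>(t, x). \<Sum>l\<in>int_decode ` {..<N}. c l t * char (- (of_int l * x)))" for N
  have S [measurable]: "S N \<in> borel_measurable unit2_lborel" for N
    unfolding S_def by measurable
  have S_diff: "l2sq unit2_lborel (\<lambda>z. S j z - S i z) = ennreal (\<Sum>n=i..<j. \<beta> n)" if "i \<le> j" for i j
  proof -
    have "int_decode ` {..<j} = int_decode ` {..<i} \<union> int_decode ` {i..<j}"
      using that by (auto simp flip: image_Un simp: ivl_disj_un)
    moreover have "int_decode ` {..<i} \<inter> int_decode ` {i..<j} = {}"
      by (subst image_Int[OF inj_int_decode, symmetric]) auto
    ultimately have "(\<lambda>z. S j z - S i z) =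
        (\<lambda>(t, x). \<Sum>l\<in>int_decode ` {i..<j}. c l t * char (- (of_int l * x)))"
      by (simp add: S_def fun_eq_iff sum.union_disjoint)
    then have "l2sq unit2_lborel (\<lambda>z. S j z - S i z) = (\<Sum>l\<in>int_decode ` {i..<j}. l2sq unit_lborel (c l))"
      by (simp only:) (rule l2sq_trig_sum_unit2, auto)
    also have "\<dots> = (\<Sum>n=i..<j. b n)"
      by (simp add: sum.reindex[OF inj] b_def)
    finally show ?thesis using \<beta> by (simp add: sum_ennreal)
  qed
  have cauchy: "\<exists>N. \<forall>i\<ge>N. \<forall>j\<ge>N.
      (\<integral>\<^sup>+z. ennreal ((cmod (S i z - S j z))\<^sup>2) \<partial>unit2_lborel) \<le> ennreal e" if "e > 0" for e
  proof -
    have "\<exists>N. \<forall>m\<ge>N. \<forall>n. norm (sum \<beta> {m..<n}) < e"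
      using \<open>summable \<beta>\<close> \<open>e > 0\<close> by (simp add: summable_Cauchy)
    then obtain N where N: "\<forall>m\<ge>N. \<forall>n. norm (sum \<beta> {m..<n}) < e" ..
    have *: "l2sq unit2_lborel (\<lambda>z. S j z - S i z) \<le> ennreal e" if "i \<ge> N" "i \<le> j" for i j
      unfolding S_diff[OF \<open>i \<le> j\<close>] using N[rule_format, OF \<open>i \<ge> N\<close>, of j] by (intro ennreal_leI) auto
    have "l2sq unit2_lborel (\<lambda>z. S i z - S j z) \<le> ennreal e" if "i \<ge> N" "j \<ge> N" for i j
      using *[of i j] *[of j i] l2sq_minus[of unit2_lborel "S i" "S j"] that
      by (cases "i \<le> j") auto
    then show ?thesis unfolding l2sq_def by blast
  qed
  from square_integrable_complete[OF S cauchy]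
  obtain g where g [measurable]: "g \<in> borel_measurable unit2_lborel"
    and lim: "\<And>e. e > 0 \<Longrightarrow> \<exists>N. \<forall>i\<ge>N. l2sq unit2_lborel (\<lambda>z. S i z - g z) \<le> ennreal e"
    unfolding l2sq_def by blast
  have S_fin: "l2sq unit2_lborel (S N) < \<infinity>" for N
    using S_diff[of 0 N] by (simp add: S_def case_prod_unfold)
  have g_fin: "l2sq unit2_lborel g < \<infinity>"
  proof -
    obtain N where N: "\<forall>i\<ge>N. l2sq unit2_lborel (\<lambda>z. S i z - g z) \<le> ennreal 1"
      using lim[of 1] by auto
    then have d: "l2sq unit2_lborel (\<lambda>z. S N z - g z) < \<infinity>"
      by (auto intro: le_less_trans)
    have m: "(\<lambda>z. S N z - g z) \<in> borel_measurable unit2_lborel"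
      by measurable
    have "l2sq unit2_lborel (\<lambda>z. S N z - (S N z - g z)) < \<infinity>"
      by (rule l2sq_diff_finite[OF S m S_fin d])
    then show ?thesis by simp
  qed
  have coeff: "AE t in unit_lborel. fourier_coeff (\<lambda>x. g (t, x)) l = c l t" for l
  proof -
    \<comment> \<open>Bessel's inequality for the single frequency \<open>l\<close>, applied to
      \<open>S k - g\<close>, bounds the norm of \<open>d\<close> by the distance from
      \<open>S k\<close> to \<open>g\<close>.\<close>
    define d where "d t = c l t - fourier_coeff (\<lambda>x. g (t, x)) l" for t
    have [measurable]: "d \<in> borel_measurable unit_lborel"
      unfolding d_def by measurable
    have "l2sq unit_lborel d \<le> 0 + ennreal e" if "e > 0" for e
    proof -
      from lim[OF \<open>e > 0\<close>] obtain N
        where N: "\<forall>i\<ge>N. l2sq unit2_lborel (\<lambda>z. S i z - g z) \<le> ennreal e" ..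
      obtain n where n: "int_decode n = l"
        using surj_int_decode by (metis surjD)
      \<comment> \<open>\<open>Suc n\<close> makes the frequency \<open>l\<close> occur in the
        partial sum \<open>S k\<close>, so that the \<open>l\<close>-th coefficient of
        \<open>S k\<close> is exactly \<open>c l\<close>.\<close>
      define k where "k = max N (Suc n)"
      have l: "l \<in> int_decode ` {..<k}" using n by (auto simp: k_def)
      have "AE t in unit_lborel. fourier_coeff (\<lambda>x. S k (t, x) - g (t, x)) l = d t"
        using AE_section_integrable[OF S S_fin, of k] AE_section_integrable[OF g g_fin]
      proof eventually_elim
        case (elim t)
        then have "fourier_coeff (\<lambda>x. S k (t, x) - g (t, x)) l =
            fourier_coeff (\<lambda>x. S k (t, x)) l - fourier_coeff (\<lambda>x. g (t, x)) l"
          by (rule fourier_coeff_diff)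
        then show ?case
          using l fourier_coeff_trig_sum[of "int_decode ` {..<k}" "\<lambda>l. c l t" l] by (simp add: S_def d_def)
      qed
      then have "l2sq unit_lborel d = l2sq unit_lborel (\<lambda>t. fourier_coeff (\<lambda>x. S k (t, x) - g (t, x)) l)"
        by (intro l2sq_cong_AE) auto
      also have "\<dots> \<le> l2sq unit2_lborel (\<lambda>z. S k z - g z)"
        using bessel_identity_unit2[of "\<lambda>z. S k z - g z" "{l}"] l2sq_diff_finite[OF S g S_fin g_fin, of k]
        by simp
      also have "\<dots> \<le> ennreal e" using N by (simp add: k_def)
      finally show ?thesis by simp
    qed
    then have "l2sq unit_lborel d \<le> 0"
      by (rule ennreal_le_epsilon)
    then have "AE t in unit_lborel. d t = 0"
      by (simp add: l2sq_eq_0_iff)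
    then show ?thesis by eventually_elim (simp add: d_def)
  qed
  \<comment> \<open>Now that the coefficients of \<open>g\<close> are known to be the
    \<open>c l\<close>, the remainder in Bessel's identity is \<open>g - S N\<close>.\<close>
  have bessel: "l2sq unit2_lborel g = l2sq unit2_lborel (\<lambda>z. S N z - g z) + (\<Sum>n<N. b n)" for N
  proof -
    let ?L = "int_decode ` {..<N}"
    have "AE t in unit_lborel. \<forall>l. fourier_coeff (\<lambda>x. g (t, x)) l = c l t"
      using coeff by (subst AE_all_countable) auto
    then have *: "AE t in unit_lborel. AE x in unit_lborel. g (t, x) -
        (\<Sum>l\<in>?L. fourier_coeff (\<lambda>x. g (t, x)) l * char (- (of_int l * x))) = g (t, x) - S N (t, x)"
      by eventually_elim (simp add: S_def)
    have "AE z in unit2_lborel. (\<lambda>(t, x). g (t, x) -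
        (\<Sum>l\<in>?L. fourier_coeff (\<lambda>x. g (t, x)) l * char (- (of_int l * x)))) z = g z - S N z"
      by (rule unit2.AE_pair_measure, measurable) (use * in simp)
    then have "l2sq unit2_lborel (\<lambda>(t, x). g (t, x) -
        (\<Sum>l\<in>?L. fourier_coeff (\<lambda>x. g (t, x)) l * char (- (of_int l * x)))) =
        l2sq unit2_lborel (\<lambda>z. g z - S N z)"
      by (rule l2sq_cong_AE)
    moreover have "(\<Sum>l\<in>?L. l2sq unit_lborel (\<lambda>t. fourier_coeff (\<lambda>x. g (t, x)) l)) = (\<Sum>n<N. b n)"
      using l2sq_cong_AE[OF coeff] by (simp add: sum.reindex[OF inj] b_def)
    ultimately show ?thesis
      using bessel_identity_unit2[OF g g_fin, of ?L] l2sq_minus[of unit2_lborel g "S N"] by simp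
  qed
  have "(\<lambda>N. l2sq unit2_lborel (\<lambda>z. S N z - g z)) \<longlonglongrightarrow> 0"
  proof (rule order_tendstoI)
    fix a :: ennreal assume "0 < a"
    then obtain b where "0 < b" "b < a" using dense by blast
    then obtain e where e: "e > 0" "ennreal e < a"
      by (cases b) auto
    from lim[OF e(1)] obtain N where "\<forall>i\<ge>N. l2sq unit2_lborel (\<lambda>z. S i z - g z) \<le> ennreal e" ..
    then show "\<forall>\<^sub>F N in sequentially. l2sq unit2_lborel (\<lambda>z. S N z - g z) < a"
      using e(2) by (intro eventually_sequentiallyI[of N]) (auto intro: le_less_trans)
  qed simp
  then have "(\<lambda>N. l2sq unit2_lborel (\<lambda>z. S N z - g z) + (\<Sum>n<N. b n)) \<longlonglongrightarrow> 0 + (\<Sum>n. b n)"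
    by (intro tendsto_add summable_LIMSEQ summableI)
  then have "l2sq unit2_lborel g = (\<Sum>n. b n)"
    unfolding bessel[symmetric] by (simp add: LIMSEQ_const_iff)
  then show ?thesis
    using that[OF g] sum_b coeff by simp
qed

text \<open>Bessel's inequality makes the coefficients of \<open>g\<close> square summable,
  Riesz-Fischer builds from them a function \<open>f\<close> with the right norm, and uniqueness of
  Fourier coefficients on almost every section gives \<open>f = g\<close> almost everywhere.\<close>

lemma parseval_unit2:
  assumes g [measurable]: "g \<in> borel_measurable unit2_lborel" and fin: "l2sq unit2_lborel g < \<infinity>"
  shows "(\<integral>\<^sup>+l. l2sq unit_lborel (\<lambda>t. fourier_coeff (\<lambda>x. g (t, x)) l) \<partial>count_space UNIV) =
    l2sq unit2_lborel g"
proof -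
  define c where "c l t = fourier_coeff (\<lambda>x. g (t, x)) l" for l t
  have c [measurable]: "c l \<in> borel_measurable unit_lborel" for l
    unfolding c_def by measurable
  have "(\<integral>\<^sup>+l. l2sq unit_lborel (c l) \<partial>count_space UNIV) = (\<Sum>n. l2sq unit_lborel (c (int_decode n)))"
    using nn_integral_bij_count_space[OF bij_int_decode, of "\<lambda>l. l2sq unit_lborel (c l)"]
    by (simp add: nn_integral_count_space_nat)
  also have "\<dots> \<le> l2sq unit2_lborel g"
  proof (rule suminf_le_const[OF summableI])
    fix N
    have "(\<Sum>n<N. l2sq unit_lborel (c (int_decode n))) = (\<Sum>l\<in>int_decode ` {..<N}. l2sq unit_lborel (c l))"
      by (subst sum.reindex) (auto intro: inj_int_decode)
    also have "\<dots> \<le> l2sq unit2_lborel g"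
      using bessel_identity_unit2[OF g fin, of "int_decode ` {..<N}"]
      by (simp add: c_def[abs_def] add_increasing)
    finally show "(\<Sum>n<N. l2sq unit_lborel (c (int_decode n))) \<le> l2sq unit2_lborel g" .
  qed
  finally have cfin: "(\<integral>\<^sup>+l. l2sq unit_lborel (c l) \<partial>count_space UNIV) < \<infinity>"
    using fin by (rule le_less_trans)
  from riesz_fischer_unit2[OF c cfin] obtain f where f [measurable]: "f \<in> borel_measurable unit2_lborel"
    and f_norm: "l2sq unit2_lborel f = (\<integral>\<^sup>+l. l2sq unit_lborel (c l) \<partial>count_space UNIV)"
    and f_coeff: "\<And>l. AE t in unit_lborel. fourier_coeff (\<lambda>x. f (t, x)) l = c l t"
    by blast
  have f_fin: "l2sq unit2_lborel f < \<infinity>" using f_norm cfin by simp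
  have "AE t in unit_lborel. \<forall>l. fourier_coeff (\<lambda>x. f (t, x)) l = c l t"
    using f_coeff by (subst AE_all_countable) auto
  then have "AE t in unit_lborel. AE x in unit_lborel. f (t, x) = g (t, x)"
    using AE_section_integrable[OF g fin] AE_section_integrable[OF f f_fin]
  proof eventually_elim
    case (elim t)
    then have "AE x in unit_lborel. f (t, x) - g (t, x) = 0"
      by (intro fourier_coeff_eq_0_imp_AE_0) (auto simp: fourier_coeff_diff c_def)
    then show ?case by eventually_elim simp
  qed
  then have "AE z in unit2_lborel. f z = g z"
    by (intro unit2.AE_pair_measure) measurable
  then have "l2sq unit2_lborel f = l2sq unit2_lborel g"
    by (rule l2sq_cong_AE)
  then show ?thesis using f_norm by (simp add: c_def[abs_def])
qed

section \<open>Slicing the line\<close>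

text \<open>The line is the disjoint union of the translates of [0,1), and over each fixed
  \<open>t\<close> the twist merely permutes the translates.\<close>

lemma nn_integral_lborel_slices:
  fixes F :: "real \<Rightarrow> ennreal" and a :: "real \<Rightarrow> int"
  assumes F [measurable]: "F \<in> borel_measurable borel"
    and a [measurable]: "a \<in> measurable borel (count_space UNIV)"
  shows "(\<integral>\<^sup>+s. F s \<partial>lborel) =
    (\<integral>\<^sup>+j. \<integral>\<^sup>+t. F (t + of_int (j - a t)) \<partial>unit_lborel \<partial>count_space UNIV)"
proof -
  have a' [measurable]: "a \<in> measurable unit_lborel (count_space UNIV)"
    using a by (simp add: measurable_restrict_space1)
  have "(\<integral>\<^sup>+s. F s \<partial>lborel) =
      (\<integral>\<^sup>+s. \<integral>\<^sup>+i. F s * indicator {of_int i..<of_int i + 1} s \<partial>count_space (UNIV :: int set) \<partial>lborel)"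
  proof (rule nn_integral_cong)
    fix s :: real
    have "s \<in> {of_int i..<of_int i + 1} \<longleftrightarrow> i \<in> {\<lfloor>s\<rfloor>}" for i :: int
      using floor_eq_iff[of s i] by auto
    then have "indicator {of_int i..<of_int i + 1} s = (indicator {\<lfloor>s\<rfloor>} i :: ennreal)" for i :: int
      by (simp only: indicator_def)
    then show "F s = (\<integral>\<^sup>+i. F s * indicator {of_int i..<of_int i + 1} s \<partial>count_space (UNIV :: int set))"
      by (simp add: nn_integral_cmult_indicator)
  qed
  also have "\<dots> = (\<integral>\<^sup>+i. \<integral>\<^sup>+s. F s * indicator {of_int i..<of_int i + 1} s \<partial>lborel \<partial>count_space (UNIV :: int set))"
    by (rule nn_integral_count_space_nn_integral) auto
  also have "\<dots> = (\<integral>\<^sup>+i. \<integral>\<^sup>+t. F (t + of_int i) \<partial>unit_lborel \<partial>count_space (UNIV :: int set))"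
  proof (rule nn_integral_cong)
    fix i :: int
    have "(\<integral>\<^sup>+s. F s * indicator {of_int i..<of_int i + 1} s \<partial>lborel) =
        (\<integral>\<^sup>+t. F (of_int i + 1 * t) * indicator {of_int i..<of_int i + 1} (of_int i + 1 * t) \<partial>lborel)"
      by (subst nn_integral_real_affine[where c = 1 and t = "of_int i"]) auto
    also have "\<dots> = (\<integral>\<^sup>+t. F (t + of_int i) * indicator {0..<1} t \<partial>lborel)"
      by (intro nn_integral_cong) (auto simp: indicator_def add.commute)
    also have "\<dots> = (\<integral>\<^sup>+t. F (t + of_int i) \<partial>unit_lborel)"
      by (simp add: nn_integral_restrict_space)
    finally show "(\<integral>\<^sup>+s. F s * indicator {of_int i..<of_int i + 1} s \<partial>lborel) = \<dots>" .
  qed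
  \<comment> \<open>The sum is moved inside the integral because the reindexing by
    \<open>a t\<close> is a bijection of the integers only once \<open>t\<close> is fixed;
    afterwards it is moved out again.\<close>
  also have "\<dots> = (\<integral>\<^sup>+t. \<integral>\<^sup>+i. F (t + of_int i) \<partial>count_space (UNIV :: int set) \<partial>unit_lborel)"
    by (rule nn_integral_count_space_nn_integral[symmetric]) auto
  also have "\<dots> = (\<integral>\<^sup>+t. \<integral>\<^sup>+j. F (t + of_int (j - a t)) \<partial>count_space UNIV \<partial>unit_lborel)"
  proof (rule nn_integral_cong)
    fix t
    have "bij (\<lambda>j. j - a t)"
      by (rule o_bij[of "\<lambda>j. j + a t"]) auto
    from nn_integral_bij_count_space[OF this, of "\<lambda>i. F (t + of_int i)"]
    show "(\<integral>\<^sup>+i. F (t + of_int i) \<partial>count_space UNIV) =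
        (\<integral>\<^sup>+j. F (t + of_int (j - a t)) \<partial>count_space UNIV)" by simp
  qed
  also have "\<dots> = (\<integral>\<^sup>+j. \<integral>\<^sup>+t. F (t + of_int (j - a t)) \<partial>unit_lborel \<partial>count_space UNIV)"
    by (rule nn_integral_count_space_nn_integral) auto
  finally show ?thesis .
qed

text \<open>The slicing formula is applied to the indicator of the exceptional set, whose integral
  over every slice is 0.\<close>

lemma AE_lborel_slices:
  fixes a :: "real \<Rightarrow> int"
  assumes P [measurable]: "Measurable.pred borel P"
    and a [measurable]: "a \<in> measurable borel (count_space UNIV)"
    and AE: "\<And>j. AE t in unit_lborel. P (t + of_int (j - a t))"
  shows "AE s in lborel. P s"
proof -
  define F :: "real \<Rightarrow> ennreal" where "F s = (if P s then 0 else 1)" for s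
  have [measurable]: "F \<in> borel_measurable borel"
    unfolding F_def by measurable
  have "(\<integral>\<^sup>+t. F (t + of_int (j - a t)) \<partial>unit_lborel) = (\<integral>\<^sup>+t. 0 \<partial>unit_lborel)" for j
    by (rule nn_integral_cong_AE) (use AE[of j] in \<open>eventually_elim, simp add: F_def\<close>)
  then have "(\<integral>\<^sup>+s. F s \<partial>lborel) = 0"
    by (subst nn_integral_lborel_slices[of F a]) auto
  then have "AE s in lborel. F s = 0"
    by (subst (asm) nn_integral_0_iff_AE) auto
  then show ?thesis by eventually_elim (simp add: F_def split: if_splits)
qed

lemma nn_integral_count_space_residues:
  fixes G :: "int \<Rightarrow> ennreal"
  assumes q: "q > 0"
  shows "(\<integral>\<^sup>+j. G j \<partial>count_space UNIV) =
    (\<Sum>k\<in>{0..<q}. \<integral>\<^sup>+l. G (k + q * l) \<partial>count_space UNIV)"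
proof -
  have "G j = (\<Sum>k\<in>{0..<q}. G j * indicator {j. j mod q = k} j)" for j
  proof -
    have "(\<Sum>k\<in>{0..<q}. G j * indicator {j. j mod q = k} j) = (\<Sum>k\<in>{0..<q}. if k = j mod q then G j else 0)"
      by (intro sum.cong) (auto simp: indicator_def)
    then show ?thesis using q by simp
  qed
  then have "(\<integral>\<^sup>+j. G j \<partial>count_space UNIV) =
      (\<integral>\<^sup>+j. (\<Sum>k\<in>{0..<q}. G j * indicator {j. j mod q = k} j) \<partial>count_space UNIV)"
    by simp
  also have "\<dots> = (\<Sum>k\<in>{0..<q}. \<integral>\<^sup>+j. G j * indicator {j. j mod q = k} j \<partial>count_space UNIV)"
    by (rule nn_integral_sum) simp
  also have "\<dots> = (\<Sum>k\<in>{0..<q}. \<integral>\<^sup>+l. G (k + q * l) \<partial>count_space UNIV)"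
  proof (rule sum.cong[OF refl])
    fix k assume k: "k \<in> {0..<q}"
    have "bij_betw (\<lambda>l. k + q * l) UNIV {j. j mod q = k}"
    proof (rule bij_betwI[where g = "\<lambda>j. j div q"])
      fix j assume "j \<in> {j. j mod q = k}"
      then show "k + q * (j div q) = j" by (auto simp: mult.commute)
    qed (use k in auto)
    from nn_integral_bij_count_space[OF this, of G]
    show "(\<integral>\<^sup>+j. G j * indicator {j. j mod q = k} j \<partial>count_space UNIV) =
        (\<integral>\<^sup>+l. G (k + q * l) \<partial>count_space UNIV)"
      by (simp add: nn_integral_count_space_indicator)
  qed
  finally show ?thesis .
qed

section \<open>Square-integrable functions and sections\<close>

lemma L2_functions_iff: "f \<in> L2_functions M \<longleftrightarrow> f \<in> borel_measurable M \<and> l2sq M f < \<infinity>"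
  by (auto simp: L2_functions_def l2sq_def integrable_iff_bounded)

text \<open>Polarization with the four powers of the imaginary unit: it reduces preservation of
  inner products to the norm identity, and it also yields integrability of the product.\<close>

lemma
  assumes [measurable]: "f \<in> borel_measurable M" "g \<in> borel_measurable M"
    and fin: "l2sq M f < \<infinity>" "l2sq M g < \<infinity>"
  shows integrable_mult_cnj: "integrable M (\<lambda>x. f x * cnj (g x))"
    and integral_polarization: "(\<integral>x. f x * cnj (g x) \<partial>M) =
      (\<Sum>n<4. \<i> ^ n * of_real (enn2real (l2sq M (\<lambda>x. f x + \<i> ^ n * g x)))) / 4"
proof -
  have "l2sq M (\<lambda>x. \<i> ^ n * g x) < \<infinity>" for n
    using fin(2) by (simp add: l2sq_cmult norm_power)
  then have fin': "l2sq M (\<lambda>x. f x + \<i> ^ n * g x) < \<infinity>" for n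
    by (intro l2sq_add_finite fin) auto
  have int: "integrable M (\<lambda>x. (cmod (f x + \<i> ^ n * g x))\<^sup>2)" for n
    using fin'[of n] by (intro integrableI_nonneg) (auto simp: l2sq_def)
  have val: "(\<integral>x. (cmod (f x + \<i> ^ n * g x))\<^sup>2 \<partial>M) = enn2real (l2sq M (\<lambda>x. f x + \<i> ^ n * g x))" for n
    unfolding l2sq_def by (rule integral_eq_nn_integral) auto
  have polar: "z * cnj w = (\<Sum>n<4. \<i> ^ n * of_real ((cmod (z + \<i> ^ n * w))\<^sup>2)) / 4" for z w
    unfolding cmod_power2
    by (simp add: numeral_eq_Suc complex_eq_iff power2_eq_square algebra_simps)
  show "integrable M (\<lambda>x. f x * cnj (g x))"
    unfolding polar by (intro integrable_divide Bochner_Integration.integrable_sum integrable_mult_right integrable_of_real int)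
  have "(\<integral>x. f x * cnj (g x) \<partial>M) =
      (\<Sum>n<4. \<i> ^ n * of_real (\<integral>x. (cmod (f x + \<i> ^ n * g x))\<^sup>2 \<partial>M)) / 4"
    unfolding polar using int
    by (simp del: of_real_power add: integral_complex_of_real)
  then show "(\<integral>x. f x * cnj (g x) \<partial>M) =
      (\<Sum>n<4. \<i> ^ n * of_real (enn2real (l2sq M (\<lambda>x. f x + \<i> ^ n * g x)))) / 4"
    by (simp only: val)
qed

lemma periodic_mod:
  fixes \<phi> :: "int \<Rightarrow> 'a"
  assumes "\<And>k. \<phi> (k + q) = \<phi> k"
  shows "\<phi> (k + q * l) = \<phi> k"
proof (induction l rule: int_induct[where k = 0])
  case (step1 i)
  then show ?case using assms[of "k + q * i"] by (simp add: algebra_simps)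
next
  case (step2 i)
  then show ?case using assms[of "k + q * (i - 1)"] by (simp add: algebra_simps)
qed simp

abbreviation cyclic_sections :: "int \<Rightarrow> (real \<times> real \<Rightarrow> int \<Rightarrow> complex) set" where
  "cyclic_sections q \<equiv>
    L2_sections unit2_lborel (\<lambda>_. cyclic_space q) (\<lambda>n _. cyclic_delta q n)"

text \<open>Pairing with \<open>cyclic_delta q n\<close> reads off the coordinate at
  \<open>n mod q\<close>, so measurability of a section means measurability of its coordinates; the
  integrated norm is a finite sum of coordinate norms.\<close>

lemma cyclic_sections_iff:
  assumes q: "q > 0"
  shows "G \<in> cyclic_sections q \<longleftrightarrow>
    (\<forall>z\<in>space unit2_lborel. \<forall>k. G z (k + q) = G z k) \<and>
    (\<forall>k. (\<lambda>z. G z k) \<in> borel_measurable unit2_lborel) \<and>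
    (\<forall>k. l2sq unit2_lborel (\<lambda>z. G z k) < \<infinity>)"
    (is "_ \<longleftrightarrow> ?per \<and> ?meas \<and> ?fin")
proof -
  have delta: "(\<Sum>k\<in>{0..<q}. \<phi> k * cnj (cyclic_delta q n k)) = \<phi> (int n mod q)" for \<phi> n
  proof -
    have "(\<Sum>k\<in>{0..<q}. \<phi> k * cnj (cyclic_delta q n k)) = (\<Sum>k\<in>{0..<q}. if k = int n mod q then \<phi> k else 0)"
      by (intro sum.cong) (auto simp: cyclic_delta_def)
    then show ?thesis using q by simp
  qed
  have "Re (\<Sum>k\<in>{0..<q}. \<phi> k * cnj (\<phi> k)) = (\<Sum>k\<in>{0..<q}. (cmod (\<phi> k))\<^sup>2)" for \<phi>
    unfolding cmod_power2 by (simp add: power2_eq_square)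
  then have iff: "G \<in> cyclic_sections q \<longleftrightarrow> ?per \<and>
      (\<forall>n. (\<lambda>z. G z (int n mod q)) \<in> borel_measurable unit2_lborel) \<and>
      integrable unit2_lborel (\<lambda>z. \<Sum>k\<in>{0..<q}. (cmod (G z k))\<^sup>2)" (is "_ \<longleftrightarrow> _ \<and> ?meas' \<and> ?int")
    by (simp add: L2_sections_def cyclic_space_def delta)
  have meas: "?meas' \<longleftrightarrow> ?meas" if ?per
  proof
    assume m: ?meas'
    show ?meas
    proof
      fix k
      \<comment> \<open>The fundamental sequence is indexed by natural numbers, so a possibly
        negative \<open>k\<close> is first replaced by its residue.\<close>
      have "(\<lambda>z. G z (int (nat (k mod q)) mod q)) \<in> borel_measurable unit2_lborel"
        using m by blast
      moreover have "G z (int (nat (k mod q)) mod q) = G z k" if "z \<in> space unit2_lborel" for z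
        using periodic_mod[of "G z" q "k mod q" "k div q"] \<open>?per\<close> that q by simp
      ultimately show "(\<lambda>z. G z k) \<in> borel_measurable unit2_lborel"
        by (simp cong: measurable_cong)
    qed
  qed simp
  have fin: "?int \<longleftrightarrow> ?fin" if ?per ?meas
  proof
    assume int: ?int
    show ?fin
    proof
      fix k
      have "l2sq unit2_lborel (\<lambda>z. G z k) \<le> (\<integral>\<^sup>+z. ennreal (\<Sum>k\<in>{0..<q}. (cmod (G z k))\<^sup>2) \<partial>unit2_lborel)"
        unfolding l2sq_def
      proof (intro nn_integral_mono ennreal_leI)
        fix z assume "z \<in> space unit2_lborel"
        then have "G z k = G z (k mod q)"
          using periodic_mod[of "G z" q "k mod q" "k div q"] \<open>?per\<close> by simp
        then show "(cmod (G z k))\<^sup>2 \<le> (\<Sum>k\<in>{0..<q}. (cmod (G z k))\<^sup>2)"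
          using member_le_sum[of "k mod q" "{0..<q}" "\<lambda>k. (cmod (G z k))\<^sup>2"] q by simp
      qed
      also have "\<dots> < \<infinity>"
        using int by (simp add: integrable_iff_bounded sum_nonneg)
      finally show "l2sq unit2_lborel (\<lambda>z. G z k) < \<infinity>" .
    qed
  next
    assume ?fin
    have [measurable]: "(\<lambda>z. G z k) \<in> borel_measurable unit2_lborel" for k
      using \<open>?meas\<close> by blast
    show ?int
      using \<open>?fin\<close> by (intro Bochner_Integration.integrable_sum integrableI_nonneg)
        (auto simp: l2sq_def)
  qed
  show ?thesis using iff meas fin by blast
qed

section \<open>The inverse Zak transform\<close>

text \<open>
  The twist \<open>a\<close> shifts the integer coordinate by an amount depending on the
  fractional coordinate; it compensates for the fractional part in the direct integral.
\<close>

definition inv_zak :: "int \<Rightarrow> (real \<Rightarrow> int) \<Rightarrow> (real \<times> real \<Rightarrow> int \<Rightarrow> complex) \<Rightarrow> real \<Rightarrow> complex" where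
  "inv_zak q a G s = (let t = frac s; j = \<lfloor>s\<rfloor> + a t in
     \<integral>x. G (t, x) j * char (of_int j * x / of_int q) \<partial>unit_lborel)"

text \<open>Each residue \<open>k\<close> modulo \<open>q\<close> contributes one function on the
  unit square. The factor is chosen so that its Fourier coefficients in the second variable are the
  values of \<open>inv_zak\<close> at the indices \<open>k + q * l\<close>.\<close>

definition zak_component :: "int \<Rightarrow> (real \<times> real \<Rightarrow> int \<Rightarrow> complex) \<Rightarrow> int \<Rightarrow> real \<times> real \<Rightarrow> complex" where
  "zak_component q G k = (\<lambda>(t, x). G (t, x) k * char (of_int k * x / of_int q))"

definition sections_l2sq :: "int \<Rightarrow> (real \<times> real \<Rightarrow> int \<Rightarrow> complex) \<Rightarrow> ennreal" where
  "sections_l2sq q G = (\<Sum>k\<in>{0..<q}. l2sq unit2_lborel (\<lambda>z. G z k))"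

context
  fixes q :: int
  assumes q: "q > 0"
begin

lemma
  assumes "G \<in> cyclic_sections q"
  shows measurable_cyclic_section: "(\<lambda>z. G z k) \<in> borel_measurable unit2_lborel"
    and l2sq_cyclic_section: "l2sq unit2_lborel (\<lambda>z. G z k) < \<infinity>"
    and periodic_cyclic_section: "z \<in> space unit2_lborel \<Longrightarrow> G z (k + q * l) = G z k"
  using assms periodic_mod[of "G z" q k l] unfolding cyclic_sections_iff[OF q] by blast+

text \<open>This one combination covers sums (\<open>c = 1\<close>), differences
  (\<open>c = -1\<close>), polarization (powers of the imaginary unit) and, with
  \<open>G' = G\<close>, scalar multiples.\<close>

lemma cyclic_sections_lincomb:
  assumes G: "G \<in> cyclic_sections q" and G': "G' \<in> cyclic_sections q"
  shows "(\<lambda>z k. G z k + c * G' z k) \<in> cyclic_sections q"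
  unfolding cyclic_sections_iff[OF q]
proof (intro conjI allI ballI)
  note [measurable] = measurable_cyclic_section[OF G] measurable_cyclic_section[OF G']
  fix k
  show "(\<lambda>z. G z k + c * G' z k) \<in> borel_measurable unit2_lborel"
    by measurable
  have "l2sq unit2_lborel (\<lambda>z. c * G' z k) < \<infinity>"
    using l2sq_cyclic_section[OF G', of k] by (simp add: l2sq_cmult ennreal_mult_less_top)
  then show "l2sq unit2_lborel (\<lambda>z. G z k + c * G' z k) < \<infinity>"
    using l2sq_cyclic_section[OF G, of k] by (intro l2sq_add_finite) auto
next
  fix z k assume "z \<in> space unit2_lborel"
  then show "G z (k + q) + c * G' z (k + q) = G z k + c * G' z k"
    using periodic_cyclic_section[OF G, of z k 1] periodic_cyclic_section[OF G', of z k 1] by simp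
qed

lemma
  assumes G: "G \<in> cyclic_sections q"
  shows measurable_zak_component: "zak_component q G k \<in> borel_measurable unit2_lborel"
    and l2sq_zak_component: "l2sq unit2_lborel (zak_component q G k) = l2sq unit2_lborel (\<lambda>z. G z k)"
proof -
  note [measurable] = measurable_cyclic_section[OF G]
  show "zak_component q G k \<in> borel_measurable unit2_lborel"
    unfolding zak_component_def by measurable
  show "l2sq unit2_lborel (zak_component q G k) = l2sq unit2_lborel (\<lambda>z. G z k)"
    by (simp add: l2sq_def zak_component_def norm_mult case_prod_unfold)
qed

lemma zak_component_finite:
  "G \<in> cyclic_sections q \<Longrightarrow> l2sq unit2_lborel (zak_component q G k) < \<infinity>"
  using l2sq_cyclic_section[of G k] by (simp only: l2sq_zak_component)

end

context
  fixes q :: int and a :: "real \<Rightarrow> int"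
  assumes q: "q > 0" and a [measurable]: "a \<in> measurable borel (count_space UNIV)"
begin

text \<open>The phase \<open>(k + q * l) * x / q\<close> splits into \<open>k * x / q\<close>,
  absorbed by \<open>zak_component\<close>, and \<open>l * x\<close>, the Fourier character;
  periodicity reduces the index of \<open>G\<close> to \<open>k\<close>. The term
  \<open>- a t\<close> in the argument cancels the twist.\<close>

lemma inv_zak_slice:
  assumes G: "G \<in> cyclic_sections q" and t: "t \<in> {0..<1}"
  shows "inv_zak q a G (t + of_int (k + q * l - a t)) =
    fourier_coeff (\<lambda>x. zak_component q G k (t, x)) l"
proof -
  let ?s = "t + of_int (k + q * l - a t)"
  have "\<lfloor>?s\<rfloor> = k + q * l - a t" "frac ?s = t"
    using t by (simp_all add: frac_def floor_eq_iff del: of_int_diff of_int_add of_int_mult)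
  then have "inv_zak q a G ?s =
      (\<integral>x. G (t, x) (k + q * l) * char (of_int (k + q * l) * x / of_int q) \<partial>unit_lborel)"
    by (simp only: inv_zak_def Let_def diff_add_cancel)
  also have "\<dots> = (\<integral>x. zak_component q G k (t, x) * char (of_int l * x) \<partial>unit_lborel)"
  proof (rule Bochner_Integration.integral_cong[OF refl])
    fix x assume "x \<in> space unit_lborel"
    then have "(t, x) \<in> space unit2_lborel"
      using t by (simp add: space_pair_measure space_unit_lborel)
    then have "G (t, x) (k + q * l) = G (t, x) k"
      by (rule periodic_cyclic_section[OF q G])
    moreover have "of_int (k + q * l) * x / of_int q = of_int k * x / of_int q + of_int l * x"
      using q by (simp add: field_simps)
    ultimately show "G (t, x) (k + q * l) * char (of_int (k + q * l) * x / of_int q) =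
        zak_component q G k (t, x) * char (of_int l * x)"
      by (simp add: zak_component_def char_add)
  qed
  finally show ?thesis by (simp add: fourier_coeff_def)
qed

lemma measurable_inv_zak:
  assumes G: "G \<in> cyclic_sections q"
  shows "inv_zak q a G \<in> borel_measurable borel"
proof -
  note [measurable] = measurable_cyclic_section[OF q G]
  have frac_borel [measurable]: "frac \<in> borel_measurable (borel :: real measure)"
    unfolding frac_def[abs_def] by measurable
  have frac: "frac \<in> measurable borel unit_lborel"
    using frac_borel by (intro measurable_restrict_space2) (auto simp: frac_lt_1)
  define C where "C j t = (\<integral>x. G (t, x) j * char (of_int j * x / of_int q) \<partial>unit_lborel)" for j t
  have C: "C j \<in> borel_measurable unit_lborel" for j
    unfolding C_def by measurable
  \<comment> \<open>The index is a measurable function of \<open>s\<close> with countably many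
    values, so measurability of \<open>C j\<close> for each fixed \<open>j\<close> suffices.\<close>
  have "(\<lambda>s. C (\<lfloor>s\<rfloor> + a (frac s)) (frac s)) \<in> borel_measurable borel"
  proof (rule measurable_compose_countable)
    show "(\<lambda>s. C j (frac s)) \<in> borel_measurable borel" for j
      by (rule measurable_compose[OF frac C])
    show "(\<lambda>s. \<lfloor>s\<rfloor> + a (frac s)) \<in> measurable borel (count_space UNIV)"
      by measurable
  qed
  then show ?thesis by (simp add: inv_zak_def[abs_def] C_def Let_def)
qed

text \<open>Slicing the line and sorting the slices by residue modulo \<open>q\<close> leaves, for
  each residue, the Fourier coefficients of one \<open>zak_component\<close>; Parseval then sums
  them over \<open>l\<close>.\<close>

lemma l2sq_inv_zak:
  assumes G: "G \<in> cyclic_sections q"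
  shows "l2sq lborel (inv_zak q a G) = sections_l2sq q G"
proof -
  note [measurable] = measurable_inv_zak[OF G]
  have "l2sq lborel (inv_zak q a G) =
      (\<integral>\<^sup>+j. \<integral>\<^sup>+t. ennreal ((cmod (inv_zak q a G (t + of_int (j - a t))))\<^sup>2) \<partial>unit_lborel \<partial>count_space UNIV)"
    unfolding l2sq_def by (rule nn_integral_lborel_slices) measurable
  also have "\<dots> = (\<Sum>k\<in>{0..<q}. \<integral>\<^sup>+l. \<integral>\<^sup>+t.
      ennreal ((cmod (inv_zak q a G (t + of_int (k + q * l - a t))))\<^sup>2) \<partial>unit_lborel \<partial>count_space UNIV)"
    by (rule nn_integral_count_space_residues[OF q])
  also have "\<dots> = (\<Sum>k\<in>{0..<q}. \<integral>\<^sup>+l.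
      l2sq unit_lborel (\<lambda>t. fourier_coeff (\<lambda>x. zak_component q G k (t, x)) l) \<partial>count_space UNIV)"
    unfolding l2sq_def
    by (intro sum.cong refl nn_integral_cong) (simp only: space_unit_lborel inv_zak_slice[OF G])
  also have "\<dots> = sections_l2sq q G"
    unfolding sections_l2sq_def
    by (intro sum.cong refl trans[OF parseval_unit2 l2sq_zak_component[OF q G]]
      measurable_zak_component[OF q G] zak_component_finite[OF q G])
  finally show ?thesis .
qed

lemma inv_zak_in_L2:
  assumes "G \<in> cyclic_sections q"
  shows "inv_zak q a G \<in> L2_functions lborel"
  using l2sq_cyclic_section[OF q assms] measurable_inv_zak[OF assms]
  by (simp add: L2_functions_iff l2sq_inv_zak[OF assms] sections_l2sq_def)

lemma int_mod_div: "\<exists>k l. k \<in> {0..<q} \<and> j = k + q * l"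
  using q by (intro exI[of _ "j mod q"] exI[of _ "j div q"]) simp

text \<open>The equality can fail at points over which a section in \<open>x\<close> is not
  integrable, since the integral is then 0 by convention. Over almost every \<open>t\<close> the
  sections are integrable.\<close>

lemma inv_zak_lincomb:
  assumes G: "G \<in> cyclic_sections q" and G': "G' \<in> cyclic_sections q"
  shows "AE s in lborel. inv_zak q a (\<lambda>z k. G z k + c * G' z k) s = inv_zak q a G s + c * inv_zak q a G' s"
proof (rule AE_lborel_slices[OF _ a])
  note GG = cyclic_sections_lincomb[OF q G G', of c]
  note [measurable] = measurable_inv_zak[OF G] measurable_inv_zak[OF G'] measurable_inv_zak[OF GG]
  show "Measurable.pred borel (\<lambda>s. inv_zak q a (\<lambda>z k. G z k + c * G' z k) s =
      inv_zak q a G s + c * inv_zak q a G' s)"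
    by measurable
  fix j
  obtain k l where j: "j = k + q * l" using int_mod_div by blast
  show "AE t in unit_lborel. inv_zak q a (\<lambda>z k. G z k + c * G' z k) (t + of_int (j - a t)) =
      inv_zak q a G (t + of_int (j - a t)) + c * inv_zak q a G' (t + of_int (j - a t))"
    using AE_section_integrable[OF measurable_zak_component[OF q G] zak_component_finite[OF q G], of k]
      AE_section_integrable[OF measurable_zak_component[OF q G'] zak_component_finite[OF q G'], of k] AE_space
  proof eventually_elim
    case (elim t)
    have *: "integrable unit_lborel (\<lambda>x. f x * char (of_int l * x))" if "integrable unit_lborel f" for f
      by (rule integrable_mult_bounded[OF that, where B = 1]) auto
    have t: "t \<in> {0..<1}" using elim(3) by (simp only: space_unit_lborel)
    have "zak_component q (\<lambda>z k. G z k + c * G' z k) k (t, x) * char (of_int l * x) =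
        zak_component q G k (t, x) * char (of_int l * x) + c * (zak_component q G' k (t, x) * char (of_int l * x))" for x
      by (simp add: zak_component_def algebra_simps)
    then have "fourier_coeff (\<lambda>x. zak_component q (\<lambda>z k. G z k + c * G' z k) k (t, x)) l =
        fourier_coeff (\<lambda>x. zak_component q G k (t, x)) l + c * fourier_coeff (\<lambda>x. zak_component q G' k (t, x)) l"
      using *[OF elim(1)] *[OF elim(2)] by (simp add: fourier_coeff_def)
    then show ?case
      unfolding j inv_zak_slice[OF G t] inv_zak_slice[OF G' t] inv_zak_slice[OF GG t] .
  qed
qed

text \<open>Both sides say that the difference \<open>D\<close> has norm 0, and the transform
  preserves norms.\<close>

lemma inv_zak_AE_eq_iff:
  assumes G: "G \<in> cyclic_sections q" and G': "G' \<in> cyclic_sections q"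
  shows "(AE s in lborel. inv_zak q a G s = inv_zak q a G' s) \<longleftrightarrow> (AE z in unit2_lborel. G z = G' z)"
proof -
  define D where "D z k = G z k + (- 1) * G' z k" for z k
  have D: "D \<in> cyclic_sections q"
    unfolding D_def by (rule cyclic_sections_lincomb[OF q G G'])
  have lin: "AE s in lborel. inv_zak q a D s = inv_zak q a G s + (- 1) * inv_zak q a G' s"
    unfolding D_def by (rule inv_zak_lincomb[OF G G'])
  have "(AE s in lborel. inv_zak q a G s = inv_zak q a G' s) \<longleftrightarrow> (AE s in lborel. inv_zak q a D s = 0)"
  proof
    assume "AE s in lborel. inv_zak q a G s = inv_zak q a G' s"
    then show "AE s in lborel. inv_zak q a D s = 0" using lin by eventually_elim simp
  next
    assume "AE s in lborel. inv_zak q a D s = 0"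
    then show "AE s in lborel. inv_zak q a G s = inv_zak q a G' s" using lin by eventually_elim simp
  qed
  also have "\<dots> \<longleftrightarrow> l2sq lborel (inv_zak q a D) = 0"
    using measurable_inv_zak[OF D] by (subst l2sq_eq_0_iff) auto
  also have "\<dots> \<longleftrightarrow> (\<forall>k\<in>{0..<q}. l2sq unit2_lborel (\<lambda>z. D z k) = 0)"
    by (simp add: l2sq_inv_zak[OF D] sections_l2sq_def)
  also have "\<dots> \<longleftrightarrow> (\<forall>k\<in>{0..<q}. AE z in unit2_lborel. D z k = 0)"
    using measurable_cyclic_section[OF q D] by (simp only: l2sq_eq_0_iff)
  also have "\<dots> \<longleftrightarrow> (AE z in unit2_lborel. \<forall>k\<in>{0..<q}. D z k = 0)"
    by (rule AE_ball_countable[symmetric]) simp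
  also have "\<dots> \<longleftrightarrow> (AE z in unit2_lborel. G z = G' z)"
  proof
    assume "AE z in unit2_lborel. \<forall>k\<in>{0..<q}. D z k = 0"
    then show "AE z in unit2_lborel. G z = G' z"
      using AE_space
    proof eventually_elim
      case (elim z)
      \<comment> \<open>Equality in the fibre is equality of functions on all integers, while the
        norm controls only the residues in \<open>{0..<q}\<close>; periodicity bridges the
        gap.\<close>
      have "G z j = G' z j" for j
      proof -
        obtain k l where "k \<in> {0..<q}" "j = k + q * l" using int_mod_div by blast
        then show ?thesis
          using elim periodic_cyclic_section[OF q G elim(2)] periodic_cyclic_section[OF q G' elim(2)]
          by (simp add: D_def)
      qed
      then show ?case by blast
    qed
  next
    assume "AE z in unit2_lborel. G z = G' z"
    then show "AE z in unit2_lborel. \<forall>k\<in>{0..<q}. D z k = 0"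
      by eventually_elim (simp add: D_def)
  qed
  finally show ?thesis .
qed

text \<open>The slices of \<open>f\<close> in one residue class are prescribed as Fourier
  coefficients; Riesz-Fischer supplies a function on the unit square for each of the
  \<open>q\<close> classes.\<close>

lemma inv_zak_surj:
  assumes f: "f \<in> L2_functions lborel"
  shows "\<exists>G\<in>cyclic_sections q. AE s in lborel. inv_zak q a G s = f s"
proof -
  have f_meas [measurable]: "f \<in> borel_measurable borel" and f_fin: "l2sq lborel f < \<infinity>"
    using f by (auto simp: L2_functions_iff)
  have a' [measurable]: "a \<in> measurable unit_lborel (count_space UNIV)"
    using a by (simp add: measurable_restrict_space1)
  define c where "c k l t = f (t + of_int (k + q * l - a t))" for k l t
  have c [measurable]: "c k l \<in> borel_measurable unit_lborel" for k l
    unfolding c_def by measurable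
  have "l2sq lborel f = (\<Sum>k\<in>{0..<q}. \<integral>\<^sup>+l. l2sq unit_lborel (c k l) \<partial>count_space UNIV)"
    unfolding l2sq_def c_def
    by (subst nn_integral_lborel_slices[OF _ a], measurable) (rule nn_integral_count_space_residues[OF q])
  then have fin: "(\<integral>\<^sup>+l. l2sq unit_lborel (c k l) \<partial>count_space UNIV) < \<infinity>" if "k \<in> {0..<q}" for k
    using f_fin that by simp
  define Q :: "int \<Rightarrow> (real \<times> real \<Rightarrow> complex) \<Rightarrow> bool" where "Q k g \<longleftrightarrow> g \<in> borel_measurable unit2_lborel \<and> l2sq unit2_lborel g < \<infinity> \<and>
      (\<forall>l. AE t in unit_lborel. fourier_coeff (\<lambda>x. g (t, x)) l = c k l t)" for k g
  have "\<exists>g. Q k g" if k: "k \<in> {0..<q}" for k :: int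
  proof -
    from riesz_fischer_unit2[OF c fin[OF k]] obtain g where "g \<in> borel_measurable unit2_lborel"
      and "l2sq unit2_lborel g = (\<integral>\<^sup>+l. l2sq unit_lborel (c k l) \<partial>count_space UNIV)"
      and "\<And>l. AE t in unit_lborel. fourier_coeff (\<lambda>x. g (t, x)) l = c k l t"
      by blast
    then have "Q k g" using fin[OF k] by (simp add: Q_def)
    then show ?thesis by (rule exI[where P = "Q k"])
  qed
  then have "\<forall>k\<in>{0..<q}. \<exists>g. Q k g" by blast
  from bchoice[OF this] obtain g where "\<forall>k\<in>{0..<q}. Q k (g k)" ..
  then have g: "g k \<in> borel_measurable unit2_lborel" "l2sq unit2_lborel (g k) < \<infinity>"
    "AE t in unit_lborel. fourier_coeff (\<lambda>x. g k (t, x)) l = c k l t" if "k \<in> {0..<q}" for k l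
    using that by (auto simp: Q_def)
  \<comment> \<open>The character undoes the factor in \<open>zak_component\<close>. Using
    \<open>j mod q\<close> in the phase as well makes the section exactly periodic, since
    \<open>char (j * x / q)\<close> alone is not \<open>q\<close>-periodic in
    \<open>j\<close>.\<close>
  define G where "G z j = g (j mod q) z * char (- (of_int (j mod q) * snd z / of_int q))" for z j
  have G: "G \<in> cyclic_sections q"
    unfolding cyclic_sections_iff[OF q]
  proof (intro conjI allI ballI)
    fix j
    have j: "j mod q \<in> {0..<q}" using q by simp
    note [measurable] = g(1)[OF j]
    show "(\<lambda>z. G z j) \<in> borel_measurable unit2_lborel"
      unfolding G_def by measurable
    show "l2sq unit2_lborel (\<lambda>z. G z j) < \<infinity>"
      using g(2)[OF j] by (simp add: G_def l2sq_def norm_mult)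
  qed (simp add: G_def)
  have zak: "zak_component q G k (t, x) = g k (t, x)" if "k \<in> {0..<q}" for k t x
    using that by (simp add: zak_component_def G_def mult.assoc char_add[symmetric])
  note [measurable] = measurable_inv_zak[OF G]
  have "AE s in lborel. inv_zak q a G s = f s"
  proof (rule AE_lborel_slices[OF _ a])
    fix j
    obtain k l where k: "k \<in> {0..<q}" and j: "j = k + q * l" using int_mod_div by blast
    show "AE t in unit_lborel. inv_zak q a G (t + of_int (j - a t)) = f (t + of_int (j - a t))"
      using g(3)[OF k, of l] AE_space
    proof eventually_elim
      case (elim t)
      then have t: "t \<in> {0..<1}" by (simp only: space_unit_lborel)
      show ?case
        unfolding j inv_zak_slice[OF G t] zak[OF k] using elim(1) by (simp only: c_def)
    qed
  qed measurable
  with G show ?thesis by blast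
qed

text \<open>Polarization on the line, the norm identity for the four combinations
  \<open>G + \<i> ^ n * G'\<close>, and polarization back on each coordinate over the unit
  square.\<close>

lemma inv_zak_inner:
  assumes G: "G \<in> cyclic_sections q" and G': "G' \<in> cyclic_sections q"
  shows "(\<integral>s. inv_zak q a G s * cnj (inv_zak q a G' s) \<partial>lborel) =
    (\<integral>z. (\<Sum>k\<in>{0..<q}. G z k * cnj (G' z k)) \<partial>unit2_lborel)"
proof -
  define N where "N n = enn2real (sections_l2sq q (\<lambda>z k. G z k + \<i> ^ n * G' z k))" for n
  have fin: "l2sq lborel (inv_zak q a G) < \<infinity>" "l2sq lborel (inv_zak q a G') < \<infinity>"
    using inv_zak_in_L2[OF G] inv_zak_in_L2[OF G'] by (auto simp: L2_functions_iff)
  have N: "enn2real (l2sq lborel (\<lambda>s. inv_zak q a G s + \<i> ^ n * inv_zak q a G' s)) = N n" for n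
    unfolding N_def l2sq_inv_zak[OF cyclic_sections_lincomb[OF q G G'], symmetric]
    using l2sq_cong_AE[OF inv_zak_lincomb[OF G G', of "\<i> ^ n"]] by simp
  have N': "N n = (\<Sum>k\<in>{0..<q}. enn2real (l2sq unit2_lborel (\<lambda>z. G z k + \<i> ^ n * G' z k)))" for n
    unfolding N_def sections_l2sq_def
    using l2sq_cyclic_section[OF q cyclic_sections_lincomb[OF q G G']] by (simp add: enn2real_sum)
  have "(\<integral>s. inv_zak q a G s * cnj (inv_zak q a G' s) \<partial>lborel) = (\<Sum>n<4. \<i> ^ n * of_real (N n)) / 4"
    using fin measurable_inv_zak[OF G] measurable_inv_zak[OF G'] by (subst integral_polarization) (auto simp: N)
  also have "\<dots> = (\<Sum>k\<in>{0..<q}. (\<Sum>n<4. \<i> ^ n *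
      of_real (enn2real (l2sq unit2_lborel (\<lambda>z. G z k + \<i> ^ n * G' z k)))) / 4)"
    unfolding N' of_real_sum sum_distrib_left sum_divide_distrib by (rule sum.swap)
  also have "\<dots> = (\<Sum>k\<in>{0..<q}. \<integral>z. G z k * cnj (G' z k) \<partial>unit2_lborel)"
    by (intro sum.cong refl integral_polarization[symmetric] measurable_cyclic_section[OF q G]
        measurable_cyclic_section[OF q G'] l2sq_cyclic_section[OF q G] l2sq_cyclic_section[OF q G'])
  also have "\<dots> = (\<integral>z. (\<Sum>k\<in>{0..<q}. G z k * cnj (G' z k)) \<partial>unit2_lborel)"
    by (intro Bochner_Integration.integral_sum[symmetric] integrable_mult_cnj measurable_cyclic_section[OF q G]
        measurable_cyclic_section[OF q G'] l2sq_cyclic_section[OF q G] l2sq_cyclic_section[OF q G'])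
  finally show ?thesis .
qed

end

section \<open>The two representations\<close>

lemma exp_eq_char: "exp (2 * complex_of_real pi * \<i> * of_real r) = char r"
  by (simp add: char_def cis_conv_exp mult_ac)

lemma heis_nth:
  "heis z y x $ 1 $ 3 = z" "heis z y x $ 2 $ 3 = y" "heis z y x $ 1 $ 2 = x"
  by (simp_all add: heis_def)

lemma heis_mult:
  "heis z y x ** heis z' y' x' = heis (z + z' + x * y') (y + y') (x + x')"
  by (simp add: heis_def vec_eq_iff forall_3 matrix_matrix_mult_def sum_3 algebra_simps)

lemma heis_one: "mat 1 = heis 0 0 0"
  by (simp add: heis_def vec_eq_iff forall_3 mat_def)

section \<open>The Schroedinger operators on representatives and on classes\<close>

definition schroedinger_fun ::
    "real \<Rightarrow> real \<Rightarrow> real \<Rightarrow> real \<Rightarrow> (real \<Rightarrow> complex) \<Rightarrow> real \<Rightarrow> complex" where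
  "schroedinger_fun h z y x f s = char (h * (z + s * y)) * f (s + x)"

lemma schroedinger_heis:
  "schroedinger h (heis_inclusion (heis z y x)) =
    (\<lambda>A. {u \<in> L2_functions lborel. \<exists>f\<in>A. AE s in lborel. u s = schroedinger_fun h z y x f s})"
  by (simp add: fun_eq_iff schroedinger_def heis_inclusion_def heis_nth exp_eq_char schroedinger_fun_def
    del: of_real_add of_real_mult)

lemma AE_lborel_shift_iff:
  fixes f g :: "real \<Rightarrow> complex"
  assumes [measurable]: "f \<in> borel_measurable borel" "g \<in> borel_measurable borel"
  shows "(AE s in lborel. f (s + x) = g (s + x)) \<longleftrightarrow> (AE s in lborel. f s = g s)"
proof
  assume "AE s in lborel. f (s + x) = g (s + x)"
  then have "AE s in lborel. f (- x + 1 * s + x) = g (- x + 1 * s + x)"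
    by (intro AE_borel_affine) auto
  then show "AE s in lborel. f s = g s" by simp
next
  assume "AE s in lborel. f s = g s"
  then have "AE s in lborel. f (x + 1 * s) = g (x + 1 * s)"
    by (intro AE_borel_affine) auto
  then show "AE s in lborel. f (s + x) = g (s + x)" by (simp add: add.commute)
qed

lemma L2_functions_modulated_shift:
  fixes f :: "real \<Rightarrow> complex"
  assumes f: "f \<in> L2_functions lborel"
    and u [measurable]: "u \<in> borel_measurable borel" and norm_u: "\<And>s. cmod (u s) = 1"
  shows "(\<lambda>s. u s * f (s + x)) \<in> L2_functions lborel"
proof -
  have [measurable]: "f \<in> borel_measurable borel" using f by (simp add: L2_functions_iff)
  have "l2sq lborel (\<lambda>s. u s * f (s + x)) = l2sq lborel f"
    unfolding l2sq_def
    by (subst (2) nn_integral_real_affine[where c = 1 and t = x])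
      (auto simp: norm_mult norm_u add.commute)
  then show ?thesis using f by (simp add: L2_functions_iff)
qed

lemma schroedinger_fun_in_L2:
  "f \<in> L2_functions lborel \<Longrightarrow> schroedinger_fun h z y x f \<in> L2_functions lborel"
  unfolding schroedinger_fun_def[abs_def] by (rule L2_functions_modulated_shift) auto

lemma schroedinger_fun_AE_eq_iff:
  assumes "f \<in> L2_functions lborel" "g \<in> L2_functions lborel"
  shows "(AE s in lborel. schroedinger_fun h z y x f s = schroedinger_fun h z y x g s) \<longleftrightarrow>
    (AE s in lborel. f s = g s)"
proof -
  have "char r \<noteq> 0" for r using norm_char[of r] by (metis norm_zero zero_neq_one)
  then have "(schroedinger_fun h z y x f s = schroedinger_fun h z y x g s) \<longleftrightarrow> f (s + x) = g (s + x)" for s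
    by (simp add: schroedinger_fun_def)
  then show ?thesis using AE_lborel_shift_iff[of f g x] assms by (simp add: L2_functions_iff)
qed

lemma schroedinger_class:
  assumes "f \<in> L2_functions lborel"
  shows "schroedinger h (heis_inclusion (heis z y x)) (ae_class lborel (L2_functions lborel) f) =
    ae_class lborel (L2_functions lborel) (schroedinger_fun h z y x f)"
  unfolding schroedinger_heis
  by (rule ae_class_image) (use assms schroedinger_fun_AE_eq_iff in auto)

lemma L2_functions_closed:
  assumes "f \<in> L2_functions M"
  shows "g \<in> L2_functions M \<Longrightarrow> (\<lambda>x. vadd complex_line (f x) (g x)) \<in> L2_functions M"
    and "(\<lambda>x. vscale complex_line c (f x)) \<in> L2_functions M"
  using assms by (auto simp: L2_functions_iff complex_line_def l2sq_cmult ennreal_mult_less_top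
    intro: l2sq_add_finite[unfolded infinity_ennreal_def])

lemma L2_functions_inner_measurable:
  "f \<in> L2_functions M \<Longrightarrow> g \<in> L2_functions M \<Longrightarrow>
    (\<lambda>x. vinner complex_line (f x) (g x)) \<in> borel_measurable M"
  by (auto simp: L2_functions_iff complex_line_def)

lemma unitary_op_schroedinger:
  "unitary_op (L2_space lborel) (L2_space lborel) (schroedinger h (heis_inclusion (heis z y x)))"
  unfolding L2_space_def schroedinger_heis
proof (rule unitary_op_class_space)
  fix f' assume f': "f' \<in> L2_functions (lborel :: real measure)"
  \<comment> \<open>The explicit preimage: shift back by \<open>x\<close> and cancel the phase,
    which after the shift is evaluated at \<open>s - x\<close>.\<close>
  define f where "f s = cnj (char (h * (z + (s + of_int (- x)) * y))) * f' (s + of_int (- x))" for s :: real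
  have "f \<in> L2_functions lborel"
    unfolding f_def[abs_def] by (rule L2_functions_modulated_shift[OF f']) auto
  moreover have "char r * cnj (char r) = 1" for r
    by (simp add: cnj_char char_add[symmetric])
  then have "schroedinger_fun h z y x f s = f' s" for s
    by (simp add: schroedinger_fun_def f_def mult.assoc[symmetric])
  ultimately show "\<exists>f\<in>L2_functions lborel. AE s in lborel. schroedinger_fun h z y x f s = f' s"
    by (intro bexI[of _ f]) auto
next
  fix f g assume f: "f \<in> L2_functions (lborel :: real measure)" and g: "g \<in> L2_functions (lborel :: real measure)"
  have "schroedinger_fun h z y x f s * cnj (schroedinger_fun h z y x g s) = f (of_int x + 1 * s) * cnj (g (of_int x + 1 * s))" for s :: real
  proof -
    have "char r * cnj (char r) = 1" for r
      by (simp add: cnj_char char_add[symmetric])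
    then have "(char r * v) * cnj (char r * w) = v * cnj w" for r v w
      by (metis complex_cnj_mult mult.assoc mult.left_commute mult.right_neutral)
    then show ?thesis by (simp add: schroedinger_fun_def add.commute)
  qed
  then show "(\<integral>s. vinner complex_line (schroedinger_fun h z y x f s) (schroedinger_fun h z y x g s) \<partial>lborel) =
      (\<integral>s. vinner complex_line (f s) (g s) \<partial>lborel)"
    using lborel_integral_real_affine[of 1 "\<lambda>s. f s * cnj (g s)" "of_int x"] by (simp add: complex_line_def)
next
  fix f g c
  show "AE s in lborel. schroedinger_fun h z y x (\<lambda>s. vadd complex_line (f s) (g s)) s =
      vadd complex_line (schroedinger_fun h z y x f s) (schroedinger_fun h z y x g s)"
    by (simp add: schroedinger_fun_def complex_line_def algebra_simps)
  show "AE s in lborel. schroedinger_fun h z y x (\<lambda>s. vscale complex_line c (f s)) s =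
      vscale complex_line c (schroedinger_fun h z y x f s)"
    by (simp add: schroedinger_fun_def complex_line_def)
qed (assumption | rule L2_functions_closed L2_functions_inner_measurable schroedinger_fun_in_L2
    schroedinger_fun_AE_eq_iff)+

lemma unitary_rep_schroedinger:
  "unitary_rep heis_Z (L2_space lborel) (\<lambda>n. schroedinger h (heis_inclusion n))"
  unfolding unitary_rep_def
proof (intro conjI ballI)
  fix g :: "int ^ 3 ^ 3" assume "g \<in> carrier heis_Z"
  then obtain z y x where "g = heis z y x" by (auto simp: heis_group_def)
  then show "unitary_op (L2_space lborel) (L2_space lborel) (schroedinger h (heis_inclusion g))"
    by (simp add: unitary_op_schroedinger)
next
  fix g g' :: "int ^ 3 ^ 3" and v :: "(real \<Rightarrow> complex) set"
  assume "g \<in> carrier heis_Z" "g' \<in> carrier heis_Z" "v \<in> carrier (L2_space lborel)"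
  then obtain z y x z' y' x' f where g: "g = heis z y x" "g' = heis z' y' x'"
    and f: "f \<in> L2_functions lborel" "v = ae_class lborel (L2_functions lborel) f"
    by (auto simp: heis_group_def L2_space_def carrier_class_space)
  \<comment> \<open>The inner phase is evaluated at the shifted point, \<open>(s + x) * y'\<close>;
    its part \<open>x * y'\<close> is the cocycle term of the Heisenberg product.\<close>
  have "schroedinger_fun h (z + z' + x * y') (y + y') (x + x') f =
      schroedinger_fun h z y x (schroedinger_fun h z' y' x' f)"
    by (simp add: fun_eq_iff schroedinger_fun_def mult.assoc[symmetric] char_add[symmetric])
      (simp add: algebra_simps)
  then show "schroedinger h (heis_inclusion (g \<otimes>\<^bsub>heis_Z\<^esub> g')) v =
      schroedinger h (heis_inclusion g) (schroedinger h (heis_inclusion g') v)"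
    by (simp add: g f heis_group_def heis_mult schroedinger_class schroedinger_fun_in_L2)
next
  fix v :: "(real \<Rightarrow> complex) set"
  assume "v \<in> carrier (L2_space lborel)"
  then obtain f where f: "f \<in> L2_functions lborel" "v = ae_class lborel (L2_functions lborel) f"
    by (auto simp: L2_space_def carrier_class_space)
  have "schroedinger_fun h 0 0 0 f = f"
    by (simp add: fun_eq_iff schroedinger_fun_def)
  then show "schroedinger h (heis_inclusion \<one>\<^bsub>heis_Z\<^esub>) v = v"
    using schroedinger_class[OF f(1), of h 0 0 0] by (simp add: f heis_group_def heis_one)
qed

section \<open>The finite-dimensional representations and their square-integrable sections\<close>

lemma rat_denom_quotient:
  assumes "q > 0" "coprime p q"
  shows "rat_denom (of_nat p / of_nat q) = int q"
proof -
  have "of_nat p / of_nat q = Fract (int p) (int q)"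
    by (simp add: Fract_of_int_quotient)
  then show ?thesis
    using assms by (simp add: rat_denom_def quotient_of_Fract normalize_stable)
qed

lemma rho_fin_heis:
  assumes "q > 0" "coprime p q"
  shows "rho_fin (of_nat p / of_nat q, x2, x3) (heis n1 n2 n3) \<phi> k =
    char ((of_int n3 * x3 + of_int n2 * x2 + of_int n1 * real p + of_int k * of_int n2 * real p) / real q)
    * \<phi> (k + n3)"
proof -
  have char: "exp (2 * complex_of_real pi * \<i> / of_real (real q) * of_real r) = char (r / real q)" for r
    using exp_eq_char[of "r / real q"] by (simp add: field_simps)
  have p: "r * real q * of_rat (of_nat p / of_nat q) = r * real p" for r
    using assms by (simp add: of_rat_divide)
  show ?thesis
    unfolding rho_fin_def Let_def prod.case rat_denom_quotient[OF assms] heis_nth of_int_of_nat_eq p char ..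
qed

lemma vinner_cyclic_section_measurable:
  assumes q: "q > 0" and s: "s \<in> cyclic_sections q" and t: "t \<in> cyclic_sections q"
  shows "(\<lambda>z. vinner (cyclic_space q) (s z) (t z)) \<in> borel_measurable unit2_lborel"
proof -
  note [measurable] = measurable_cyclic_section[OF q s] measurable_cyclic_section[OF q t]
  show ?thesis unfolding cyclic_space_def by simp
qed

lemma cyclic_sections_closed:
  assumes q: "q > 0" and s: "s \<in> cyclic_sections q"
  shows "t \<in> cyclic_sections q \<Longrightarrow> (\<lambda>z. vadd (cyclic_space q) (s z) (t z)) \<in> cyclic_sections q"
    and "(\<lambda>z. vscale (cyclic_space q) c (s z)) \<in> cyclic_sections q"
  \<comment> \<open>A multiple is obtained from the same closure property by writing
    \<open>c * s\<close> as \<open>s + (c - 1) * s\<close>.\<close>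
  using cyclic_sections_lincomb[OF q s, of t 1] cyclic_sections_lincomb[OF q s s, of "c - 1"]
  by (simp_all add: cyclic_space_def algebra_simps)

lemma unitary_op_inv_zak:
  assumes q: "q > 0" and a: "a \<in> measurable borel (count_space UNIV)"
  shows "unitary_op (class_space unit2_lborel (\<lambda>_. cyclic_space q) (cyclic_sections q)) (L2_space lborel)
    (\<lambda>A. {u \<in> L2_functions lborel. \<exists>G\<in>A. AE s in lborel. u s = inv_zak q a G s})"
  unfolding L2_space_def
proof (rule unitary_op_class_space)
  fix G G' assume G: "G \<in> cyclic_sections q" and G': "G' \<in> cyclic_sections q"
  show "AE s in lborel. inv_zak q a (\<lambda>z. vadd (cyclic_space q) (G z) (G' z)) s =
      vadd complex_line (inv_zak q a G s) (inv_zak q a G' s)"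
    using inv_zak_lincomb[OF q a G G', of 1] by (simp add: cyclic_space_def complex_line_def)
  show "(\<integral>s. vinner complex_line (inv_zak q a G s) (inv_zak q a G' s) \<partial>lborel) =
      (\<integral>z. vinner (cyclic_space q) (G z) (G' z) \<partial>unit2_lborel)"
    using inv_zak_inner[OF q a G G'] by (simp add: cyclic_space_def complex_line_def)
next
  fix c G
  \<comment> \<open>In contrast to additivity, scaling holds at every point: a constant factor moves
    through the Bochner integral even when the integrand is not integrable.\<close>
  have "inv_zak q a (\<lambda>z. vscale (cyclic_space q) c (G z)) s = vscale complex_line c (inv_zak q a G s)" for s
    by (simp add: inv_zak_def Let_def cyclic_space_def complex_line_def mult.assoc)
  then show "AE s in lborel. inv_zak q a (\<lambda>z. vscale (cyclic_space q) c (G z)) s =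
      vscale complex_line c (inv_zak q a G s)" by simp
qed (assumption | rule vinner_cyclic_section_measurable[OF q] cyclic_sections_closed[OF q]
    L2_functions_inner_measurable inv_zak_in_L2[OF q a] inv_zak_surj[OF q a]
    inv_zak_AE_eq_iff[OF q a])+

theorem theorem2p5:
  fixes p q :: nat and x1 :: rat and h :: real
    and m :: "real measure" and H :: "real \<times> real \<Rightarrow> (int \<Rightarrow> complex) ip_space"
    and e :: "nat \<Rightarrow> real \<times> real \<Rightarrow> int \<Rightarrow> complex"
  assumes "p > 0" and "q > 0" and "coprime p q"
    and "x1 = of_nat p / of_nat q" and "x1 \<in> {0<..1}"
    and "h = of_rat x1"
  defines "m \<equiv> restrict_space lborel {0..<1}"
    and "H \<equiv> \<lambda>_. cyclic_space (rat_denom x1)"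
    and "e \<equiv> \<lambda>n _. cyclic_delta (rat_denom x1) n"
  shows "unitarily_equivalent heis_Z
    (L2_space lborel) (\<lambda>n. schroedinger h (heis_inclusion n))
    (direct_integral (m \<Otimes>\<^sub>M m) H e)
    (direct_integral_rep (m \<Otimes>\<^sub>M m) H e
       (\<lambda>(x2, x3). rho_fin (x1, frac (real q * of_rat x1 * x2), x3)))"
proof -
  define Q where "Q = int q"
  have Q: "Q > 0" using \<open>q > 0\<close> by (simp add: Q_def)
  have x1: "rat_denom x1 = Q"
    using assms by (simp add: rat_denom_quotient Q_def)
  have h: "h = real p / real q"
    using assms by (simp add: of_rat_divide)
  \<comment> \<open>Thus the fractional part in the theorem is that of \<open>p * x2\<close>, which
    is the quantity compensated by the twist below.\<close>
  have px: "real q * of_rat x1 = real p"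
    using assms by (simp add: of_rat_divide)
  \<comment> \<open>\<open>u\<close> inverts \<open>p\<close> modulo \<open>q\<close>; the other
    Bezout coefficient \<open>v\<close> returns in the integer defect \<open>N\<close> of the
    phases.\<close>
  obtain u v where uv: "u * int p + v * int q = 1"
    using bezout_int[of "int p" "int q"] \<open>coprime p q\<close> by auto
  define a where "a t = u * \<lfloor>real p * t\<rfloor>" for t
  have a: "a \<in> measurable borel (count_space UNIV)"
    unfolding a_def by measurable
  define S where "S = cyclic_sections Q"
  define K where "K = class_space unit2_lborel (\<lambda>_. cyclic_space Q) S"
  define R where "R n G = (\<lambda>(x2, x3). rho_fin (x1, frac (real p * x2), x3) n (G (x2, x3)))" for n G
  define \<sigma> where "\<sigma> n A = {w \<in> S. \<exists>G\<in>A. AE z in unit2_lborel. w z = R n G z}" for n A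
  define V where "V A = {w \<in> L2_functions lborel. \<exists>G\<in>A. AE s in lborel. w s = inv_zak Q a G s}" for A
  have K: "direct_integral (m \<Otimes>\<^sub>M m) H e = K"
    by (simp add: direct_integral_def K_def S_def m_def H_def e_def x1)
  have \<sigma>: "direct_integral_rep (m \<Otimes>\<^sub>M m) H e
      (\<lambda>(x2, x3). rho_fin (x1, frac (real q * of_rat x1 * x2), x3)) = \<sigma>"
    by (simp add: fun_eq_iff direct_integral_rep_def \<sigma>_def R_def S_def m_def H_def e_def x1 px case_prod_unfold)
  have R: "R (heis n1 n2 n3) G (t, x) k =
      char ((of_int n3 * x + of_int n2 * frac (real p * t) + of_int n1 * real p
        + of_int k * of_int n2 * real p) / real q) * G (t, x) (k + n3)" for n1 n2 n3 G t x k
    using rho_fin_heis[OF \<open>q > 0\<close> \<open>coprime p q\<close>] assms(4) by (simp add: R_def)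
  have R_in: "R (heis n1 n2 n3) G \<in> S" if G: "G \<in> S" for n1 n2 n3 G
    unfolding S_def cyclic_sections_iff[OF Q]
  proof (intro conjI allI ballI)
    note G' = G[unfolded S_def]
    fix k
    note [measurable] = measurable_cyclic_section[OF Q G']
    have [measurable]: "frac \<in> borel_measurable (borel :: real measure)"
      unfolding frac_def[abs_def] by measurable
    have *: "(\<lambda>z. R (heis n1 n2 n3) G z k) = (\<lambda>(t, x). char ((of_int n3 * x + of_int n2 * frac (real p * t)
        + of_int n1 * real p + of_int k * of_int n2 * real p) / real q) * G (t, x) (k + n3))"
      by (auto simp: fun_eq_iff R)
    show "(\<lambda>z. R (heis n1 n2 n3) G z k) \<in> borel_measurable unit2_lborel"
      unfolding * by measurable
    have "l2sq unit2_lborel (\<lambda>z. R (heis n1 n2 n3) G z k) = l2sq unit2_lborel (\<lambda>z. G z (k + n3))"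
      unfolding * by (simp add: l2sq_def norm_mult case_prod_unfold)
    then show "l2sq unit2_lborel (\<lambda>z. R (heis n1 n2 n3) G z k) < \<infinity>"
      using l2sq_cyclic_section[OF Q G'] by simp
  next
    fix z :: "real \<times> real" and k assume z: "z \<in> space unit2_lborel"
    obtain t x where tx: "z = (t, x)" by fastforce
    have "G (t, x) (k + Q + n3) = G (t, x) (k + n3)"
      using periodic_cyclic_section[OF Q G[unfolded S_def] z, of "k + n3" 1] tx by (simp add: algebra_simps)
    \<comment> \<open>Raising \<open>k\<close> by \<open>q\<close> adds the integer
      \<open>n2 * p\<close> to the argument of \<open>char\<close>, so the action preserves
      periodicity.\<close>
    moreover have "(of_int n3 * x + of_int n2 * frac (real p * t) + of_int n1 * real p
          + of_int (k + Q) * of_int n2 * real p) / real q =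
        (of_int n3 * x + of_int n2 * frac (real p * t) + of_int n1 * real p
          + of_int k * of_int n2 * real p) / real q + of_int (n2 * int p)"
      using \<open>q > 0\<close> by (simp add: Q_def field_simps)
    ultimately show "R (heis n1 n2 n3) G z (k + Q) = R (heis n1 n2 n3) G z k"
      unfolding tx R by (simp only: char_add_int)
  qed
  have \<sigma>_class: "\<sigma> (heis n1 n2 n3) (ae_class unit2_lborel S G) = ae_class unit2_lborel S (R (heis n1 n2 n3) G)"
    if "G \<in> S" for n1 n2 n3 G
    unfolding \<sigma>_def
  proof (rule ae_class_image[OF that])
    fix G' assume "AE z in unit2_lborel. G' z = G z"
    then show "AE z in unit2_lborel. R (heis n1 n2 n3) G' z = R (heis n1 n2 n3) G z"
      by eventually_elim (simp add: R_def case_prod_unfold)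
  qed
  have V_class: "V (ae_class unit2_lborel S G) = ae_class lborel (L2_functions lborel) (inv_zak Q a G)"
    if "G \<in> S" for G
    unfolding V_def
    by (rule ae_class_image[OF that]) (use that inv_zak_AE_eq_iff[OF Q a] in \<open>auto simp: S_def\<close>)
  \<comment> \<open>Both actions are phases combined with a shift of the index, and the Schroedinger
    phase does not involve \<open>x\<close>; the relation thus amounts to taking a constant out of
    the integral and holds at every \<open>s\<close>.\<close>
  have tw: "inv_zak Q a (R (heis n1 n2 n3) G) s = schroedinger_fun h n1 n2 n3 (inv_zak Q a G) s"
    for n1 n2 n3 G s
  proof -
    define t where "t = frac s"
    define j where "j = \<lfloor>s\<rfloor> + a t"
    \<comment> \<open>As \<open>u * p = 1 - v * q\<close>, multiplying the twist by \<open>p\<close>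
      gives the integer part of \<open>p * t\<close> minus \<open>v * q\<close> times it. After
      division by \<open>q\<close> the second term becomes the integer \<open>N\<close>, invisible
      to \<open>char\<close>.\<close>
    define N where "N = - (n2 * \<lfloor>real p * t\<rfloor> * v)"
    have s: "s = t + of_int \<lfloor>s\<rfloor>" by (simp add: t_def frac_def)
    have uv': "real_of_int u * real p = 1 - real_of_int v * real q"
      using arg_cong[OF uv, of real_of_int] by simp
    \<comment> \<open>The fibre phase \<open>n3 * x / q\<close> joins the transform phase at
      \<open>j\<close> to form the one at \<open>j + n3\<close>; the twist adds to the fractional
      part of \<open>p * t\<close> the integer part that it lacks.\<close>
    have phase: "(of_int n3 * x + of_int n2 * frac (real p * t) + of_int n1 * real p
        + of_int j * of_int n2 * real p) / real q + of_int j * x / of_int Q =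
      h * (of_int n1 + s * of_int n2) + of_int (j + n3) * x / of_int Q + of_int N" for x
    proof -
      define r where "r = real_of_int \<lfloor>real p * t\<rfloor>"
      have j: "of_int j * real p = of_int \<lfloor>s\<rfloor> * real p + r * (1 - real_of_int v * real q)"
        unfolding uv'[symmetric] by (simp add: j_def a_def r_def algebra_simps)
      have fr: "frac (real p * t) = real p * t - r" by (simp add: frac_def r_def)
      have "of_int n3 * x + of_int n2 * frac (real p * t) + of_int n1 * real p
          + of_int n2 * (of_int j * real p) + of_int j * x =
        real p * (of_int n1 + s * of_int n2) + of_int (j + n3) * x + real q * of_int N"
        unfolding j fr by (subst s) (simp add: N_def r_def algebra_simps)
      then have "(of_int n3 * x + of_int n2 * frac (real p * t) + of_int n1 * real p
          + of_int n2 * (of_int j * real p) + of_int j * x) / real q =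
        (real p * (of_int n1 + s * of_int n2) + of_int (j + n3) * x + real q * of_int N) / real q"
        by simp
      then show ?thesis
        using \<open>q > 0\<close> by (simp add: h Q_def add_divide_distrib mult_ac)
    qed
    have "R (heis n1 n2 n3) G (t, x) j * char (of_int j * x / of_int Q) =
        char (h * (of_int n1 + s * of_int n2)) * (G (t, x) (j + n3) * char (of_int (j + n3) * x / of_int Q))" for x
    proof -
      have "R (heis n1 n2 n3) G (t, x) j * char (of_int j * x / of_int Q) =
          G (t, x) (j + n3) * char ((of_int n3 * x + of_int n2 * frac (real p * t) + of_int n1 * real p
            + of_int j * of_int n2 * real p) / real q + of_int j * x / of_int Q)"
        unfolding R char_add by (simp only: mult_ac)
      also have "\<dots> = G (t, x) (j + n3) * (char (h * (of_int n1 + s * of_int n2)) * char (of_int (j + n3) * x / of_int Q))"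
        unfolding phase by (simp only: char_add char_int mult_1_right)
      finally show ?thesis by (simp only: mult_ac)
    qed
    then have "inv_zak Q a (R (heis n1 n2 n3) G) s = char (h * (of_int n1 + s * of_int n2)) *
        (\<integral>x. G (t, x) (j + n3) * char (of_int (j + n3) * x / of_int Q) \<partial>unit_lborel)"
      by (simp add: inv_zak_def Let_def t_def[symmetric] j_def[symmetric] del: of_int_add)
    also have "(\<integral>x. G (t, x) (j + n3) * char (of_int (j + n3) * x / of_int Q) \<partial>unit_lborel) =
        inv_zak Q a G (s + of_int n3)"
    proof -
      \<comment> \<open>An integer translation keeps the fractional coordinate, hence also the
        twist, and moves only the index.\<close>
      have "frac (s + of_int n3) = t" "\<lfloor>s + of_int n3\<rfloor> + a t = j + n3"
        by (simp_all add: t_def j_def frac_def)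
      then show ?thesis by (simp only: inv_zak_def Let_def)
    qed
    finally show ?thesis by (simp add: schroedinger_fun_def)
  qed
  have V: "unitary_op K (L2_space lborel) V"
    using unitary_op_inv_zak[OF Q a] by (simp add: K_def S_def V_def[abs_def])
  have closed: "v \<in> carrier K \<Longrightarrow> w \<in> carrier K \<Longrightarrow> vadd K v w \<in> carrier K"
    "v \<in> carrier K \<Longrightarrow> vscale K c v \<in> carrier K" for v w c
    using class_space_closed[of S "\<lambda>_. cyclic_space Q"] cyclic_sections_closed[OF Q]
    by (auto simp: K_def S_def)
  show ?thesis
    unfolding K \<sigma>
  \<comment> \<open>Only closure of \<open>K\<close> under \<open>\<sigma>\<close> and the
    intertwining relation remain, and both are checked on representatives.\<close>
  proof (rule unitarily_equivalent_if_intertwiner[OF group_heis_group unitary_rep_schroedinger V _ _ closed])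
    fix n :: "int ^ 3 ^ 3" and A
    assume "n \<in> carrier heis_Z" "A \<in> carrier K"
    then obtain n1 n2 n3 G where n: "n = heis n1 n2 n3" and G: "G \<in> S" "A = ae_class unit2_lborel S G"
      by (auto simp: heis_group_def K_def carrier_class_space)
    show "\<sigma> n A \<in> carrier K"
      using R_in[OF G(1)] by (simp add: n G \<sigma>_class K_def carrier_class_space)
    have "inv_zak Q a G \<in> L2_functions lborel"
      using inv_zak_in_L2[OF Q a] G(1) by (simp add: S_def)
    moreover have "inv_zak Q a (R (heis n1 n2 n3) G) = schroedinger_fun h n1 n2 n3 (inv_zak Q a G)"
      using tw by blast
    ultimately show "V (\<sigma> n A) = schroedinger h (heis_inclusion n) (V A)"
      by (simp add: n G \<sigma>_class V_class R_in schroedinger_class)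
  qed
qed

end
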